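(* Let $\mathcal{M}$ be a cofibrantly generated model category, let $m \geq 1$, let $X, Y, Z : \mathbf{R}^m \to \mathcal{M}$ be functors, and let $\epsilon_1, \epsilon_2, \delta_1, \delta_2 \geq 0 \in \mathbf{R}^m$. If $X$ and $Y$ are $(\epsilon_1,\epsilon_2)$-homotopy interleaved and $Y$ and $Z$ are $(\delta_1,\delta_2)$-homotopy interleaved, then $X$ and $Z$ are $(\epsilon_1+\delta_1,\epsilon_2+\delta_2)$-homotopy interleaved.
   Context: $\mathbf{R}^m$ is the poset of $m$-tuples of reals with the product order. For a functor $X : \mathbf{R}^m \to C$ and $\delta \geq 0 \in \mathbf{R}^m$, $X^\delta : \mathbf{R}^m \to C$ is $X^\delta(r) = X(r+\delta)$ with the shifted structure morphisms; this is functorial in $X$. An $(\epsilon,\delta)$-interleaving between $X, Y : \mathbf{R}^m \to C$ consists of natural transformations $f : X \to Y^\epsilon$ and $g : Y \to X^\delta$ such that $g^\epsilon \circ f : X \to X^{\epsilon+\delta}$ and $f^\delta \circ g : Y \to Y^{\epsilon+\delta}$ are the natural transformations given by the structure morphisms of $X$ and of $Y$, respectively. Weak equivalences in $\mathcal{M}^{\mathbf{R}^m}$ are pointwise, and $\simeq$ means being connected by a zig-zag of weak equivalences in $\mathcal{M}^{\mathbf{R}^m}$. $X, Y \in \mathcal{M}^{\mathbf{R}^m}$ are $(\epsilon,\delta)$-homotopy interleaved if there exist $X' \simeq X$ and $Y' \simeq Y$ such that $X'$ and $Y'$ are $(\epsilon,\delta)$-interleaved. *)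

theory Defs
  imports "HOL-Analysis.Analysis"
begin

unbundle cardinal_syntax

section \<open>Categories, functors, natural transformations\<close>

record ('o, 'a) cat =
  Obj :: "'o set"
  Arr :: "'a set"
  Dom :: "'a \<Rightarrow> 'o"
  Cod :: "'a \<Rightarrow> 'o"
  Ident :: "'o \<Rightarrow> 'a"
  Comp :: "'a \<Rightarrow> 'a \<Rightarrow> 'a"  (infixl "\<cdot>\<index>" 70)

definition Hom :: "('o, 'a, 'x) cat_scheme \<Rightarrow> 'o \<Rightarrow> 'o \<Rightarrow> 'a set" where
  "Hom C x y = {f \<in> Arr C. Dom C f = x \<and> Cod C f = y}"

locale category =
  fixes C :: "('o, 'a, 'x) cat_scheme" (structure)
  assumes Dom_Obj: "f \<in> Arr C \<Longrightarrow> Dom C f \<in> Obj C"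
    and Cod_Obj: "f \<in> Arr C \<Longrightarrow> Cod C f \<in> Obj C"
    and Ident_Hom: "x \<in> Obj C \<Longrightarrow> Ident C x \<in> Hom C x x"
    and Comp_Hom: "\<lbrakk>f \<in> Hom C x y; g \<in> Hom C y z\<rbrakk> \<Longrightarrow> g \<cdot> f \<in> Hom C x z"
    and Comp_Ident: "f \<in> Hom C x y \<Longrightarrow> f \<cdot> Ident C x = f"
    and Ident_Comp: "f \<in> Hom C x y \<Longrightarrow> Ident C y \<cdot> f = f"
    and Comp_assoc: "\<lbrakk>f \<in> Hom C w x; g \<in> Hom C x y; h \<in> Hom C y z\<rbrakk>
        \<Longrightarrow> (h \<cdot> g) \<cdot> f = h \<cdot> (g \<cdot> f)"

record ('o, 'a, 'p, 'b) fctr =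
  FObj :: "'o \<Rightarrow> 'p"
  FArr :: "'a \<Rightarrow> 'b"

locale is_functor = J: category J + C: category C
  for J :: "('o, 'a, 'x) cat_scheme" and C :: "('p, 'b, 'y) cat_scheme"
    and F :: "('o, 'a, 'p, 'b) fctr" +
  assumes FObj_Obj: "x \<in> Obj J \<Longrightarrow> FObj F x \<in> Obj C"
    and FArr_Hom: "f \<in> Hom J x y \<Longrightarrow> FArr F f \<in> Hom C (FObj F x) (FObj F y)"
    and FArr_Ident: "x \<in> Obj J \<Longrightarrow> FArr F (Ident J x) = Ident C (FObj F x)"
    and FArr_Comp: "\<lbrakk>f \<in> Hom J x y; g \<in> Hom J y z\<rbrakk>
        \<Longrightarrow> FArr F (g \<cdot>\<^bsub>J\<^esub> f) = FArr F g \<cdot>\<^bsub>C\<^esub> FArr F f"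

locale nat_trans = F: is_functor J C F + G: is_functor J C G
  for J :: "('o, 'a, 'x) cat_scheme" and C :: "('p, 'b, 'y) cat_scheme"
    and F G :: "('o, 'a, 'p, 'b) fctr" and t :: "'o \<Rightarrow> 'b" +
  assumes component: "x \<in> Obj J \<Longrightarrow> t x \<in> Hom C (FObj F x) (FObj G x)"
    and naturality: "f \<in> Hom J x y \<Longrightarrow> t y \<cdot>\<^bsub>C\<^esub> FArr F f = FArr G f \<cdot>\<^bsub>C\<^esub> t x"

text \<open>A reflexive and transitive relation regarded as a category; a pair \<open>(a, b)\<close> is the
  unique arrow from \<open>a\<close> to \<open>b\<close>.\<close>

definition ord_cat :: "'i rel \<Rightarrow> ('i, 'i \<times> 'i) cat" where
  "ord_cat r = \<lparr>Obj = Field r, Arr = r, Dom = fst, Cod = snd,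
                Ident = (\<lambda>a. (a, a)), Comp = (\<lambda>g f. (fst f, snd g))\<rparr>"


section \<open>Limits, colimits, size\<close>

definition is_cone ::
  "('p, 'b, 'y) cat_scheme \<Rightarrow> ('o, 'a, 'x) cat_scheme \<Rightarrow> ('o, 'a, 'p, 'b) fctr \<Rightarrow>
   'p \<Rightarrow> ('o \<Rightarrow> 'b) \<Rightarrow> bool" where
  "is_cone C J D L p \<longleftrightarrow> L \<in> Obj C \<and> (\<forall>j\<in>Obj J. p j \<in> Hom C L (FObj D j)) \<and>
     (\<forall>i j. \<forall>f\<in>Hom J i j. FArr D f \<cdot>\<^bsub>C\<^esub> p i = p j)"

definition is_limit ::
  "('p, 'b, 'y) cat_scheme \<Rightarrow> ('o, 'a, 'x) cat_scheme \<Rightarrow> ('o, 'a, 'p, 'b) fctr \<Rightarrow>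
   'p \<Rightarrow> ('o \<Rightarrow> 'b) \<Rightarrow> bool" where
  "is_limit C J D L p \<longleftrightarrow> is_cone C J D L p \<and>
     (\<forall>L' p'. is_cone C J D L' p' \<longrightarrow>
        (\<exists>!u. u \<in> Hom C L' L \<and> (\<forall>j\<in>Obj J. p j \<cdot>\<^bsub>C\<^esub> u = p' j)))"

definition is_cocone ::
  "('p, 'b, 'y) cat_scheme \<Rightarrow> ('o, 'a, 'x) cat_scheme \<Rightarrow> ('o, 'a, 'p, 'b) fctr \<Rightarrow>
   'p \<Rightarrow> ('o \<Rightarrow> 'b) \<Rightarrow> bool" where
  "is_cocone C J D L c \<longleftrightarrow> L \<in> Obj C \<and> (\<forall>j\<in>Obj J. c j \<in> Hom C (FObj D j) L) \<and>
     (\<forall>i j. \<forall>f\<in>Hom J i j. c j \<cdot>\<^bsub>C\<^esub> FArr D f = c i)"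

definition is_colimit ::
  "('p, 'b, 'y) cat_scheme \<Rightarrow> ('o, 'a, 'x) cat_scheme \<Rightarrow> ('o, 'a, 'p, 'b) fctr \<Rightarrow>
   'p \<Rightarrow> ('o \<Rightarrow> 'b) \<Rightarrow> bool" where
  "is_colimit C J D L c \<longleftrightarrow> is_cocone C J D L c \<and>
     (\<forall>L' c'. is_cocone C J D L' c' \<longrightarrow>
        (\<exists>!u. u \<in> Hom C L L' \<and> (\<forall>j\<in>Obj J. u \<cdot>\<^bsub>C\<^esub> c j = c' j)))"

text \<open>``Small'' means of cardinality less than a fixed cardinal \<open>\<kappa>\<close>. For \<open>\<kappa>\<close> inaccessible these
  are the small sets of a Grothendieck universe. Only uncountability and regularity are imposed,
  since HOL does not prove that inaccessible cardinals exist.\<close>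

definition size_cardinal :: "'u rel \<Rightarrow> bool" where
  "size_cardinal \<kappa> \<longleftrightarrow> Card_order \<kappa> \<and> natLeq <o \<kappa> \<and> regularCard \<kappa>"

definition small :: "'u rel \<Rightarrow> 'b set \<Rightarrow> bool" where
  "small \<kappa> A \<longleftrightarrow> |A| <o \<kappa>"

text \<open>Index categories may be taken to live on the underlying type of \<open>\<kappa>\<close>, as every
  \<open>\<kappa>\<close>-small category has an isomorphic copy there.\<close>

definition has_small_limits :: "'u rel \<Rightarrow> ('o, 'a, 'x) cat_scheme \<Rightarrow> bool" where
  "has_small_limits \<kappa> C \<longleftrightarrow> (\<forall>(J :: ('u, 'u) cat) D.
     small \<kappa> (Obj J) \<and> small \<kappa> (Arr J) \<and> is_functor J C D \<longrightarrow> (\<exists>L p. is_limit C J D L p))"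

definition has_small_colimits :: "'u rel \<Rightarrow> ('o, 'a, 'x) cat_scheme \<Rightarrow> bool" where
  "has_small_colimits \<kappa> C \<longleftrightarrow> (\<forall>(J :: ('u, 'u) cat) D.
     small \<kappa> (Obj J) \<and> small \<kappa> (Arr J) \<and> is_functor J C D \<longrightarrow> (\<exists>L c. is_colimit C J D L c))"


section \<open>Model categories\<close>

text \<open>\<open>(u, v)\<close> is a morphism \<open>f \<rightarrow> g\<close> in the category of arrows of \<open>C\<close>.\<close>

definition square :: "('o, 'a, 'x) cat_scheme \<Rightarrow> 'a \<Rightarrow> 'a \<Rightarrow> 'a \<Rightarrow> 'a \<Rightarrow> bool" where
  "square C f g u v \<longleftrightarrow> f \<in> Arr C \<and> g \<in> Arr C \<and>
     u \<in> Hom C (Dom C f) (Dom C g) \<and> v \<in> Hom C (Cod C f) (Cod C g) \<and>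
     v \<cdot>\<^bsub>C\<^esub> f = g \<cdot>\<^bsub>C\<^esub> u"

definition lifts_against :: "('o, 'a, 'x) cat_scheme \<Rightarrow> 'a \<Rightarrow> 'a \<Rightarrow> bool" where
  "lifts_against C i p \<longleftrightarrow> (\<forall>u v. square C i p u v \<longrightarrow>
     (\<exists>h \<in> Hom C (Cod C i) (Dom C p). h \<cdot>\<^bsub>C\<^esub> i = u \<and> p \<cdot>\<^bsub>C\<^esub> h = v))"

definition arrow_retract :: "('o, 'a, 'x) cat_scheme \<Rightarrow> 'a \<Rightarrow> 'a \<Rightarrow> bool" where
  "arrow_retract C f g \<longleftrightarrow> (\<exists>u v u' v'. square C f g u v \<and> square C g f u' v' \<and>
     u' \<cdot>\<^bsub>C\<^esub> u = Ident C (Dom C f) \<and> v' \<cdot>\<^bsub>C\<^esub> v = Ident C (Cod C f))"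

definition closed_under_retracts :: "('o, 'a, 'x) cat_scheme \<Rightarrow> 'a set \<Rightarrow> bool" where
  "closed_under_retracts C A \<longleftrightarrow> (\<forall>f g. arrow_retract C f g \<and> g \<in> A \<longrightarrow> f \<in> A)"

definition two_out_of_three :: "('o, 'a, 'x) cat_scheme \<Rightarrow> 'a set \<Rightarrow> bool" where
  "two_out_of_three C A \<longleftrightarrow> (\<forall>x y z. \<forall>f\<in>Hom C x y. \<forall>g\<in>Hom C y z.
     (f \<in> A \<and> g \<in> A \<longrightarrow> g \<cdot>\<^bsub>C\<^esub> f \<in> A) \<and>
     (f \<in> A \<and> g \<cdot>\<^bsub>C\<^esub> f \<in> A \<longrightarrow> g \<in> A) \<and>
     (g \<in> A \<and> g \<cdot>\<^bsub>C\<^esub> f \<in> A \<longrightarrow> f \<in> A))"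

text \<open>\<open>f = R f \<cdot> L f\<close>, where \<open>L\<close> and \<open>R\<close> are the object parts of functors from the category of
  arrows to itself; \<open>E f g u v\<close> is the map induced on the intermediate objects by the morphism
  \<open>(u, v) : f \<rightarrow> g\<close>.\<close>

definition functorial_factorization ::
  "('o, 'a, 'x) cat_scheme \<Rightarrow> ('a \<Rightarrow> 'a) \<Rightarrow> ('a \<Rightarrow> 'a) \<Rightarrow> ('a \<Rightarrow> 'a \<Rightarrow> 'a \<Rightarrow> 'a \<Rightarrow> 'a) \<Rightarrow> bool" where
  "functorial_factorization C L R E \<longleftrightarrow>
     (\<forall>f\<in>Arr C. L f \<in> Arr C \<and> R f \<in> Arr C \<and> Dom C (L f) = Dom C f \<and>
        Cod C (L f) = Dom C (R f) \<and> Cod C (R f) = Cod C f \<and> R f \<cdot>\<^bsub>C\<^esub> L f = f) \<and>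
     (\<forall>f g u v. square C f g u v \<longrightarrow>
        E f g u v \<in> Hom C (Cod C (L f)) (Cod C (L g)) \<and>
        E f g u v \<cdot>\<^bsub>C\<^esub> L f = L g \<cdot>\<^bsub>C\<^esub> u \<and> R g \<cdot>\<^bsub>C\<^esub> E f g u v = v \<cdot>\<^bsub>C\<^esub> R f) \<and>
     (\<forall>f\<in>Arr C. E f f (Ident C (Dom C f)) (Ident C (Cod C f)) = Ident C (Cod C (L f))) \<and>
     (\<forall>f g h u v u' v'. square C f g u v \<and> square C g h u' v' \<longrightarrow>
        E f h (u' \<cdot>\<^bsub>C\<^esub> u) (v' \<cdot>\<^bsub>C\<^esub> v) = E g h u' v' \<cdot>\<^bsub>C\<^esub> E f g u v)"

record ('o, 'a) model_cat = "('o, 'a) cat" +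
  Weq :: "'a set"
  Cof :: "'a set"
  Fib :: "'a set"

text \<open>The definition of Hirschhorn (\<^emph>\<open>Model Categories and Their Localizations\<close>, 7.1.3):
  factorizations are functorial, and all small limits and colimits exist.\<close>

locale model_category = category M
  for \<kappa> :: "'u rel" and M :: "('o, 'a, 'x) model_cat_scheme" (structure) +
  assumes classes: "Weq M \<subseteq> Arr M" "Cof M \<subseteq> Arr M" "Fib M \<subseteq> Arr M"
    and limits: "has_small_limits \<kappa> M"
    and colimits: "has_small_colimits \<kappa> M"
    and two_of_three: "two_out_of_three M (Weq M)"
    and retracts: "closed_under_retracts M (Weq M)" "closed_under_retracts M (Cof M)"
      "closed_under_retracts M (Fib M)"
    and lift_trivial_fibration: "\<lbrakk>i \<in> Cof M; p \<in> Fib M \<inter> Weq M\<rbrakk> \<Longrightarrow> lifts_against M i p"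
    and lift_trivial_cofibration: "\<lbrakk>i \<in> Cof M \<inter> Weq M; p \<in> Fib M\<rbrakk> \<Longrightarrow> lifts_against M i p"
    and factor_trivial_fibration: "\<exists>L R E. functorial_factorization M L R E \<and>
      (\<forall>f\<in>Arr M. L f \<in> Cof M \<and> R f \<in> Fib M \<inter> Weq M)"
    and factor_trivial_cofibration: "\<exists>L R E. functorial_factorization M L R E \<and>
      (\<forall>f\<in>Arr M. L f \<in> Cof M \<inter> Weq M \<and> R f \<in> Fib M)"


section \<open>The small object argument and cofibrant generation\<close>

text \<open>Ordinals are represented by well-orders; a regular cardinal is represented by a
  cardinal order.\<close>

definition successor :: "'i rel \<Rightarrow> 'i \<Rightarrow> 'i \<Rightarrow> bool" where
  "successor r a b \<longleftrightarrow> (a, b) \<in> r \<and> a \<noteq> b \<and> (\<forall>c. (a, c) \<in> r \<and> (c, b) \<in> r \<longrightarrow> c = a \<or> c = b)"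

definition limit_element :: "'i rel \<Rightarrow> 'i \<Rightarrow> bool" where
  "limit_element r c \<longleftrightarrow> c \<in> Field r \<and> underS r c \<noteq> {} \<and> (\<nexists>a. successor r a c)"

text \<open>\<open>\<lambda>\<close>-sequences, \<open>\<lambda>\<close> the order type of \<open>r\<close>: functors on \<open>r\<close> that are continuous at limit
  elements.\<close>

definition transfinite_sequence ::
  "('o, 'a, 'x) cat_scheme \<Rightarrow> 'i rel \<Rightarrow> ('i, 'i \<times> 'i, 'o, 'a) fctr \<Rightarrow> bool" where
  "transfinite_sequence C r X \<longleftrightarrow> Well_order r \<and> Field r \<noteq> {} \<and> is_functor (ord_cat r) C X \<and>
     (\<forall>c. limit_element r c \<longrightarrow>
        is_colimit C (ord_cat (Restr r (underS r c))) X (FObj X c) (\<lambda>a. FArr X (a, c)))"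

definition pushout_of :: "('o, 'a, 'x) cat_scheme \<Rightarrow> 'a \<Rightarrow> 'a \<Rightarrow> bool" where
  "pushout_of C i g \<longleftrightarrow> (\<exists>h k. square C i g h k \<and>
     (\<forall>z. \<forall>s\<in>Hom C (Cod C i) z. \<forall>t\<in>Hom C (Dom C g) z. s \<cdot>\<^bsub>C\<^esub> i = t \<cdot>\<^bsub>C\<^esub> h \<longrightarrow>
        (\<exists>!u. u \<in> Hom C (Cod C g) z \<and> u \<cdot>\<^bsub>C\<^esub> k = s \<and> u \<cdot>\<^bsub>C\<^esub> g = t)))"

text \<open>Relative \<open>I\<close>-cell complexes: transfinite compositions of pushouts of elements of \<open>I\<close>.\<close>

definition relative_cell_complexes ::
  "'u rel \<Rightarrow> ('o, 'a, 'x) cat_scheme \<Rightarrow> 'a set \<Rightarrow> 'a set" where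
  "relative_cell_complexes \<kappa> C I = {c z | (r :: 'u rel) X L c z.
     transfinite_sequence C r X \<and> small \<kappa> (Field r) \<and>
     (\<forall>a b. successor r a b \<longrightarrow> (\<exists>i\<in>I. pushout_of C i (FArr X (a, b)))) \<and>
     is_colimit C (ord_cat r) X L c \<and> z \<in> Field r \<and> (\<forall>a\<in>Field r. (z, a) \<in> r)}"

text \<open>The colimit over \<open>j\<close> of the sets \<open>Hom(W, D j)\<close>, as the quotient of the disjoint union by
  the equivalence relation generated by the transition maps, and the canonical map from it to
  \<open>Hom(W, L)\<close> given by a cocone \<open>c\<close> on \<open>D\<close> with vertex \<open>L\<close>.\<close>

definition hom_step ::
  "('p, 'b, 'y) cat_scheme \<Rightarrow> ('o, 'a, 'x) cat_scheme \<Rightarrow> ('o, 'a, 'p, 'b) fctr \<Rightarrow> 'p \<Rightarrow>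
   'o \<times> 'b \<Rightarrow> 'o \<times> 'b \<Rightarrow> bool" where
  "hom_step C J D W = (\<lambda>(i, g) (j, h). i \<in> Obj J \<and> g \<in> Hom C W (FObj D i) \<and>
     (\<exists>f \<in> Hom J i j. h = FArr D f \<cdot>\<^bsub>C\<^esub> g))"

definition hom_colimit ::
  "('p, 'b, 'y) cat_scheme \<Rightarrow> ('o, 'a, 'x) cat_scheme \<Rightarrow> ('o, 'a, 'p, 'b) fctr \<Rightarrow> 'p \<Rightarrow>
   ('o \<times> 'b) set set" where
  "hom_colimit C J D W = (SIGMA j:Obj J. Hom C W (FObj D j)) //
     {(p, q). equivclp (hom_step C J D W) p q}"

definition hom_colimit_map ::
  "('p, 'b, 'y) cat_scheme \<Rightarrow> ('o \<Rightarrow> 'b) \<Rightarrow> ('o \<times> 'b) set \<Rightarrow> 'b" where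
  "hom_colimit_map C c A = the_elem ((\<lambda>(j, g). c j \<cdot>\<^bsub>C\<^esub> g) ` A)"

text \<open>\<open>W\<close> is small relative to \<open>D\<close>: there is a cardinal \<open>k\<close> such that \<open>Hom(W, -)\<close> preserves
  colimits of \<open>\<lambda>\<close>-sequences of arrows in \<open>D\<close> for all regular \<open>\<lambda> \<ge> k\<close>.\<close>

definition small_relative_to ::
  "'u rel \<Rightarrow> ('o, 'a, 'x) cat_scheme \<Rightarrow> 'a set \<Rightarrow> 'o \<Rightarrow> bool" where
  "small_relative_to \<kappa> C D W \<longleftrightarrow> (\<exists>k :: 'u rel. Card_order k \<and> small \<kappa> (Field k) \<and>
     (\<forall>(r :: 'u rel) X L c.
        Cinfinite r \<and> regularCard r \<and> small \<kappa> (Field r) \<and> k \<le>o r \<and>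
        transfinite_sequence C r X \<and> (\<forall>a b. successor r a b \<longrightarrow> FArr X (a, b) \<in> D) \<and>
        is_colimit C (ord_cat r) X L c \<longrightarrow>
        bij_betw (hom_colimit_map C c) (hom_colimit C (ord_cat r) X W) (Hom C W L)))"

definition permits_small_object_argument ::
  "'u rel \<Rightarrow> ('o, 'a, 'x) cat_scheme \<Rightarrow> 'a set \<Rightarrow> bool" where
  "permits_small_object_argument \<kappa> C I \<longleftrightarrow>
     (\<forall>i\<in>I. small_relative_to \<kappa> C (relative_cell_complexes \<kappa> C I) (Dom C i))"

locale cofibrantly_generated_model_category = model_category \<kappa> M
  for \<kappa> :: "'u rel" and M :: "('o, 'a, 'x) model_cat_scheme" (structure) +
  assumes generating_cofibrations: "\<exists>I \<subseteq> Arr M. small \<kappa> I \<and>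
      permits_small_object_argument \<kappa> M I \<and>
      (\<forall>p\<in>Arr M. p \<in> Fib M \<inter> Weq M \<longleftrightarrow> (\<forall>i\<in>I. lifts_against M i p))"
    and generating_trivial_cofibrations: "\<exists>J \<subseteq> Arr M. small \<kappa> J \<and>
      permits_small_object_argument \<kappa> M J \<and>
      (\<forall>p\<in>Arr M. p \<in> Fib M \<longleftrightarrow> (\<forall>j\<in>J. lifts_against M j p))"


section \<open>Multi-persistent objects and interleavings\<close>

type_synonym ('m, 'o, 'a) persistent = "(real ^ 'm, (real ^ 'm) \<times> (real ^ 'm), 'o, 'a) fctr"

text \<open>The order on \<^typ>\<open>real ^ 'm\<close> is the product order.\<close>

abbreviation Rm :: "(real ^ 'm, (real ^ 'm) \<times> (real ^ 'm)) cat" where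
  "Rm \<equiv> ord_cat {(r, s). r \<le> s}"

definition shift :: "real ^ 'm \<Rightarrow> ('m::finite, 'o, 'a) persistent \<Rightarrow> ('m::finite, 'o, 'a) persistent" where
  "shift \<delta> X = \<lparr>FObj = (\<lambda>r. FObj X (r + \<delta>)), FArr = (\<lambda>(r, s). FArr X (r + \<delta>, s + \<delta>))\<rparr>"

definition shift_trans :: "real ^ 'm \<Rightarrow> (real ^ 'm \<Rightarrow> 'a) \<Rightarrow> real ^ 'm \<Rightarrow> 'a" where
  "shift_trans \<delta> t = (\<lambda>r. t (r + \<delta>))"

text \<open>The transformation \<open>X \<rightarrow> X\<^sup>\<delta>\<close> (for \<open>\<delta> \<ge> 0\<close>) given by the structure morphisms of \<open>X\<close>.\<close>

definition structure_trans :: "('m::finite, 'o, 'a) persistent \<Rightarrow> real ^ 'm \<Rightarrow> real ^ 'm \<Rightarrow> 'a" where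
  "structure_trans X \<delta> = (\<lambda>r. FArr X (r, r + \<delta>))"

definition interleaved ::
  "('o, 'a, 'x) cat_scheme \<Rightarrow> real ^ 'm \<Rightarrow> real ^ 'm \<Rightarrow>
   ('m::finite, 'o, 'a) persistent \<Rightarrow> ('m::finite, 'o, 'a) persistent \<Rightarrow> bool" where
  "interleaved C \<epsilon> \<delta> X Y \<longleftrightarrow> (\<exists>f g.
     nat_trans Rm C X (shift \<epsilon> Y) f \<and> nat_trans Rm C Y (shift \<delta> X) g \<and>
     (\<forall>r. shift_trans \<epsilon> g r \<cdot>\<^bsub>C\<^esub> f r = structure_trans X (\<epsilon> + \<delta>) r) \<and>
     (\<forall>r. shift_trans \<delta> f r \<cdot>\<^bsub>C\<^esub> g r = structure_trans Y (\<epsilon> + \<delta>) r))"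

definition weak_equivalence ::
  "('o, 'a, 'x) model_cat_scheme \<Rightarrow>
   ('m::finite, 'o, 'a) persistent \<Rightarrow> ('m::finite, 'o, 'a) persistent \<Rightarrow> bool" where
  "weak_equivalence M X Y \<longleftrightarrow> (\<exists>t. nat_trans Rm M X Y t \<and> (\<forall>r. t r \<in> Weq M))"

text \<open>Connected by a zig-zag of weak equivalences.\<close>

definition weakly_equivalent ::
  "('o, 'a, 'x) model_cat_scheme \<Rightarrow>
   ('m::finite, 'o, 'a) persistent \<Rightarrow> ('m::finite, 'o, 'a) persistent \<Rightarrow> bool" where
  "weakly_equivalent M = equivclp (weak_equivalence M)"

definition homotopy_interleaved ::
  "('o, 'a, 'x) model_cat_scheme \<Rightarrow> real ^ 'm \<Rightarrow> real ^ 'm \<Rightarrow>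
   ('m::finite, 'o, 'a) persistent \<Rightarrow> ('m::finite, 'o, 'a) persistent \<Rightarrow> bool" where
  "homotopy_interleaved M \<epsilon> \<delta> X Y \<longleftrightarrow> (\<exists>X' Y'.
     weakly_equivalent M X' X \<and> weakly_equivalent M Y' Y \<and> interleaved M \<epsilon> \<delta> X' Y')"

end

theory Submission
  imports Defs
begin

text \<open>Strict interleavings compose: paste \<open>X \<rightarrow> Y\<^sup>\<epsilon>\<close> with the shift of \<open>Y \<rightarrow> Z\<^sup>\<delta>\<close>. For homotopy
  interleavings the two middle objects are different: there are an interleaving of \<open>X\<^sub>1 \<simeq> X\<close> with
  \<open>Y\<^sub>1 \<simeq> Y\<close> and an interleaving of \<open>Y\<^sub>2 \<simeq> Y\<close> with \<open>Z\<^sub>2 \<simeq> Z\<close>, where \<open>Y\<^sub>1\<close> and \<open>Y\<^sub>2\<close> are only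
  connected by a zig-zag of weak equivalences. The proof moves both interleavings to one common
  middle object, in two steps.

  The first step replaces the zig-zag by a single span \<open>Y\<^sub>1 \<leftarrow> T \<rightarrow> Y\<^sub>2\<close> whose legs are pointwise
  trivial fibrations. Applying a functorial fibrant replacement \<open>Q\<close> to every value of the diagrams
  preserves weak equivalences and interleavings, so all objects may be taken to be pointwise fibrant.
  A weak equivalence \<open>w : A \<rightarrow> B\<close> of pointwise fibrant diagrams gives such a span: factor
  \<open>(id, w) : A \<rightarrow> A \<times> B\<close> as a trivial cofibration \<open>A \<rightarrow> T\<close> and a fibration. Both projections of
  \<open>A \<times> B\<close> are fibrations, so \<open>T \<rightarrow> A\<close> and \<open>T \<rightarrow> B\<close> are fibrations, and they are weak equivalences
  by two out of three (\<open>trivial_fibration_span_of_weq\<close>). Spans compose by pullback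
  (\<open>trivial_fibration_span_trans\<close>), and this takes care of the whole zig-zag.

  The second step transports an interleaving \<open>(f, g)\<close> of \<open>X\<close> and \<open>Y\<close> along a pointwise trivial
  fibration \<open>T \<rightarrow> Y\<close> (\<open>interleaved_trivial_fibration_pullback\<close>). Regard interleavings as diagrams on
  the disjoint union of two copies of \<open>\<real>\<^sup>m\<close>, suitably ordered. Restriction to the second copy has
  the right adjoint \<open>T \<mapsto> (T\<^sup>\<epsilon>, T)\<close>, which preserves pointwise trivial fibrations. Pulling back
  \<open>(T\<^sup>\<epsilon>, T) \<rightarrow> (Y\<^sup>\<epsilon>, Y)\<close> along the unit \<open>(X, Y) \<rightarrow> (Y\<^sup>\<epsilon>, Y)\<close> yields an interleaving of
  \<open>P = X \<times> T\<^sup>\<epsilon>\<close>, the fibre product being over \<open>Y\<^sup>\<epsilon>\<close>, with \<open>T\<close>; and \<open>P \<rightarrow> X\<close> is a trivial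
  fibration since it is a pullback of one. In both steps the fibre products and factorizations are
  formed pointwise in the model category.\<close>


section \<open>Functors and natural transformations\<close>

definition fctr_comp :: "('p, 'b, 'q, 'c) fctr \<Rightarrow> ('o, 'a, 'p, 'b) fctr \<Rightarrow> ('o, 'a, 'q, 'c) fctr" where
  "fctr_comp F X = \<lparr>FObj = (\<lambda>x. FObj F (FObj X x)), FArr = (\<lambda>f. FArr F (FArr X f))\<rparr>"

definition id_fctr :: "('o, 'a, 'o, 'a) fctr" where
  "id_fctr = \<lparr>FObj = (\<lambda>x. x), FArr = (\<lambda>f. f)\<rparr>"

definition const_fctr :: "('p, 'b, 'y) cat_scheme \<Rightarrow> 'p \<Rightarrow> ('o, 'a, 'p, 'b) fctr" where
  "const_fctr C c = \<lparr>FObj = (\<lambda>_. c), FArr = (\<lambda>_. Ident C c)\<rparr>"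

lemma const_fctr_simps [simp]: "FObj (const_fctr C c) x = c" "FArr (const_fctr C c) f = Ident C c"
  by (simp_all add: const_fctr_def)

context category
begin

lemma Hom_Obj:
  assumes "f \<in> Hom C x y"
  shows "x \<in> Obj C" "y \<in> Obj C"
  using assms Dom_Obj Cod_Obj unfolding Hom_def by auto

lemma is_functor_id: "is_functor C C id_fctr"
  by unfold_locales (auto simp: id_fctr_def)

end

lemma Hom_D: "f \<in> Hom C x y \<Longrightarrow> f \<in> Arr C" "f \<in> Hom C x y \<Longrightarrow> Dom C f = x"
  "f \<in> Hom C x y \<Longrightarrow> Cod C f = y"
  by (auto simp: Hom_def)

lemma nat_transI:
  assumes "is_functor J C F" "is_functor J C G"
    and "\<And>x. x \<in> Obj J \<Longrightarrow> t x \<in> Hom C (FObj F x) (FObj G x)"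
    and "\<And>x y f. f \<in> Hom J x y \<Longrightarrow> x \<in> Obj J \<Longrightarrow> y \<in> Obj J \<Longrightarrow>
      t y \<cdot>\<^bsub>C\<^esub> FArr F f = FArr G f \<cdot>\<^bsub>C\<^esub> t x"
  shows "nat_trans J C F G t"
proof -
  interpret F: is_functor J C F by fact
  show ?thesis
    by (intro nat_trans.intro assms(1,2) nat_trans_axioms.intro assms(3,4))
      (auto dest: F.J.Hom_Obj)
qed

lemma is_functor_const:
  assumes "category J" "category C" "c \<in> Obj C"
  shows "is_functor J C (const_fctr C c)"
proof -
  interpret J: category J by fact
  interpret C: category C by fact
  have i: "Ident C c \<in> Hom C c c" using assms(3) by (rule C.Ident_Hom)
  show ?thesis
    by unfold_locales (auto simp: const_fctr_def assms(3) i C.Comp_Ident[OF i])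
qed

lemma is_functor_comp:
  assumes "is_functor C D F" "is_functor J C X"
  shows "is_functor J D (fctr_comp F X)"
proof -
  interpret F: is_functor C D F by fact
  interpret X: is_functor J C X by fact
  show ?thesis
    by unfold_locales
      (auto simp: fctr_comp_def X.FObj_Obj F.FObj_Obj X.FArr_Ident F.FArr_Ident X.FArr_Comp
        intro: F.FArr_Hom X.FArr_Hom F.FArr_Comp)
qed

lemma nat_trans_id:
  assumes "is_functor J C F"
  shows "nat_trans J C F F (\<lambda>x. Ident C (FObj F x))"
proof -
  interpret F: is_functor J C F by fact
  show ?thesis
    by (rule nat_transI[OF assms assms])
      (auto simp: F.FObj_Obj F.C.Ident_Hom F.C.Comp_Ident[OF F.FArr_Hom] F.C.Ident_Comp[OF F.FArr_Hom])
qed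

lemma nat_trans_comp:
  assumes "nat_trans J C F G s" "nat_trans J C G H t"
  shows "nat_trans J C F H (\<lambda>x. t x \<cdot>\<^bsub>C\<^esub> s x)"
proof -
  interpret s: nat_trans J C F G s by fact
  interpret t: nat_trans J C G H t by fact
  show ?thesis
  proof (rule nat_transI[OF s.F.is_functor_axioms t.G.is_functor_axioms])
    fix x assume "x \<in> Obj J"
    then show "t x \<cdot>\<^bsub>C\<^esub> s x \<in> Hom C (FObj F x) (FObj H x)"
      using s.component t.component s.F.C.Comp_Hom by blast
  next
    fix x y f assume f: "f \<in> Hom J x y" and x: "x \<in> Obj J" and y: "y \<in> Obj J"
    note h = s.component[OF x] s.component[OF y] t.component[OF x] t.component[OF y]
      s.F.FArr_Hom[OF f] s.G.FArr_Hom[OF f] t.G.FArr_Hom[OF f]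
    have "(t y \<cdot>\<^bsub>C\<^esub> s y) \<cdot>\<^bsub>C\<^esub> FArr F f = t y \<cdot>\<^bsub>C\<^esub> (FArr G f \<cdot>\<^bsub>C\<^esub> s x)"
      using s.F.C.Comp_assoc[OF h(5,2,4)] s.naturality[OF f] by simp
    also have "\<dots> = FArr H f \<cdot>\<^bsub>C\<^esub> (t x \<cdot>\<^bsub>C\<^esub> s x)"
      using s.F.C.Comp_assoc[OF h(1,6,4)] s.F.C.Comp_assoc[OF h(1,3,7)] t.naturality[OF f] by simp
    finally show "(t y \<cdot>\<^bsub>C\<^esub> s y) \<cdot>\<^bsub>C\<^esub> FArr F f = FArr H f \<cdot>\<^bsub>C\<^esub> (t x \<cdot>\<^bsub>C\<^esub> s x)" .
  qed
qed

lemma nat_trans_whisker_left: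
  assumes F: "is_functor C D F" and t: "nat_trans J C X Y t"
  shows "nat_trans J D (fctr_comp F X) (fctr_comp F Y) (\<lambda>x. FArr F (t x))"
proof -
  interpret F: is_functor C D F by fact
  interpret t: nat_trans J C X Y t by fact
  show ?thesis
  proof (rule nat_transI[OF is_functor_comp[OF F t.F.is_functor_axioms]
        is_functor_comp[OF F t.G.is_functor_axioms]])
    fix x y f assume f: "f \<in> Hom J x y" and x: "x \<in> Obj J" and y: "y \<in> Obj J"
    show "FArr F (t y) \<cdot>\<^bsub>D\<^esub> FArr (fctr_comp F X) f = FArr (fctr_comp F Y) f \<cdot>\<^bsub>D\<^esub> FArr F (t x)"
      using F.FArr_Comp[OF t.F.FArr_Hom[OF f] t.component[OF y]]
        F.FArr_Comp[OF t.component[OF x] t.G.FArr_Hom[OF f]] t.naturality[OF f]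
      by (simp add: fctr_comp_def)
  qed (auto simp: fctr_comp_def intro: F.FArr_Hom t.component)
qed

lemma nat_trans_whisker_right:
  assumes t: "nat_trans C D F G t" and X: "is_functor J C X"
  shows "nat_trans J D (fctr_comp F X) (fctr_comp G X) (\<lambda>x. t (FObj X x))"
proof -
  interpret t: nat_trans C D F G t by fact
  interpret X: is_functor J C X by fact
  show ?thesis
    by (rule nat_transI[OF is_functor_comp[OF t.F.is_functor_axioms X]
        is_functor_comp[OF t.G.is_functor_axioms X]])
      (auto simp: fctr_comp_def intro: t.component X.FObj_Obj t.naturality X.FArr_Hom)
qed

lemma fctr_comp_id: "fctr_comp id_fctr X = X"
  by (simp add: fctr_comp_def id_fctr_def)

lemma fctr_comp_const: "fctr_comp (const_fctr C c) X = const_fctr C c"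
  by (simp add: fctr_comp_def const_fctr_def)

text \<open>A functorial factorization is exactly what is needed to factor a natural transformation
  pointwise: the maps induced on the middle objects are the structure morphisms of the middle functor.\<close>

lemma factor_nat_trans:
  assumes fact: "functorial_factorization C L R E" and t: "nat_trans J C F G t"
  obtains T where "nat_trans J C F T (\<lambda>x. L (t x))" "nat_trans J C T G (\<lambda>x. R (t x))"
    "\<And>x. x \<in> Obj J \<Longrightarrow> R (t x) \<cdot>\<^bsub>C\<^esub> L (t x) = t x"
proof -
  interpret t: nat_trans J C F G t by fact
  define T where "T = \<lparr>FObj = (\<lambda>x. Cod C (L (t x))),
    FArr = (\<lambda>f. E (t (Dom J f)) (t (Cod J f)) (FArr F f) (FArr G f))\<rparr>"
  have arr: "L f \<in> Arr C \<and> R f \<in> Arr C \<and> Dom C (L f) = Dom C f \<and>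
        Cod C (L f) = Dom C (R f) \<and> Cod C (R f) = Cod C f \<and> R f \<cdot>\<^bsub>C\<^esub> L f = f"
    if "f \<in> Arr C" for f
    using fact that unfolding functorial_factorization_def by blast
  have E: "E f g u v \<in> Hom C (Cod C (L f)) (Cod C (L g)) \<and>
        E f g u v \<cdot>\<^bsub>C\<^esub> L f = L g \<cdot>\<^bsub>C\<^esub> u \<and> R g \<cdot>\<^bsub>C\<^esub> E f g u v = v \<cdot>\<^bsub>C\<^esub> R f"
    if "square C f g u v" for f g u v
    using fact that unfolding functorial_factorization_def by blast
  have E_id: "E f f (Ident C (Dom C f)) (Ident C (Cod C f)) = Ident C (Cod C (L f))"
    if "f \<in> Arr C" for f
    using fact that unfolding functorial_factorization_def by blast
  have E_comp: "E f h (u' \<cdot>\<^bsub>C\<^esub> u) (v' \<cdot>\<^bsub>C\<^esub> v) = E g h u' v' \<cdot>\<^bsub>C\<^esub> E f g u v"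
    if "square C f g u v" "square C g h u' v'" for f g h u v u' v'
    using fact that unfolding functorial_factorization_def by blast
  have tA: "t x \<in> Arr C" "Dom C (t x) = FObj F x" "Cod C (t x) = FObj G x" if "x \<in> Obj J" for x
    using t.component[OF that] by (auto simp: Hom_def)
  have sq: "square C (t x) (t y) (FArr F f) (FArr G f)" if f: "f \<in> Hom J x y" for x y f
    using t.F.J.Hom_Obj[OF f] tA t.F.FArr_Hom[OF f] t.G.FArr_Hom[OF f] t.naturality[OF f]
    by (simp add: square_def)
  have T_arr: "FArr T f = E (t x) (t y) (FArr F f) (FArr G f)" if "f \<in> Hom J x y" for x y f
    using that by (simp add: T_def Hom_def)
  have T: "is_functor J C T"
  proof unfold_locales
    fix x assume x: "x \<in> Obj J"
    show "FObj T x \<in> Obj C" using arr[OF tA(1)[OF x]] t.F.C.Cod_Obj[of "L (t x)"] by (simp add: T_def)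
    show "FArr T (Ident J x) = Ident C (FObj T x)"
      using T_arr[OF t.F.J.Ident_Hom[OF x]] E_id[OF tA(1)[OF x]]
      by (simp add: T_def t.F.FArr_Ident[OF x] t.G.FArr_Ident[OF x] tA[OF x])
  next
    fix x y f assume f: "f \<in> Hom J x y"
    show "FArr T f \<in> Hom C (FObj T x) (FObj T y)"
      unfolding T_arr[OF f] using E[OF sq[OF f]] by (simp add: T_def)
  next
    fix x y z f g assume f: "f \<in> Hom J x y" and g: "g \<in> Hom J y z"
    show "FArr T (g \<cdot>\<^bsub>J\<^esub> f) = FArr T g \<cdot>\<^bsub>C\<^esub> FArr T f"
      unfolding T_arr[OF f] T_arr[OF g] T_arr[OF t.F.J.Comp_Hom[OF f g]]
        t.F.FArr_Comp[OF f g] t.G.FArr_Comp[OF f g]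
      by (rule E_comp[OF sq[OF f] sq[OF g]])
  qed
  show thesis
  proof
    show "nat_trans J C F T (\<lambda>x. L (t x))"
    proof (rule nat_transI[OF t.F.is_functor_axioms T])
      fix x assume x: "x \<in> Obj J"
      show "L (t x) \<in> Hom C (FObj F x) (FObj T x)"
        using arr[OF tA(1)[OF x]] tA[OF x] by (simp add: T_def Hom_def)
    next
      fix x y f assume f: "f \<in> Hom J x y"
      show "L (t y) \<cdot>\<^bsub>C\<^esub> FArr F f = FArr T f \<cdot>\<^bsub>C\<^esub> L (t x)"
        unfolding T_arr[OF f] using E[OF sq[OF f]] by simp
    qed
    show "nat_trans J C T G (\<lambda>x. R (t x))"
    proof (rule nat_transI[OF T t.G.is_functor_axioms])
      fix x assume x: "x \<in> Obj J"
      show "R (t x) \<in> Hom C (FObj T x) (FObj G x)"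
        using arr[OF tA(1)[OF x]] tA[OF x] by (simp add: T_def Hom_def)
    next
      fix x y f assume f: "f \<in> Hom J x y"
      show "R (t y) \<cdot>\<^bsub>C\<^esub> FArr T f = FArr G f \<cdot>\<^bsub>C\<^esub> R (t x)"
        unfolding T_arr[OF f] using E[OF sq[OF f]] by simp
    qed
    show "R (t x) \<cdot>\<^bsub>C\<^esub> L (t x) = t x" if "x \<in> Obj J" for x
      using arr[OF tA(1)[OF that]] by simp
  qed
qed


section \<open>Pullbacks\<close>

text \<open>The square has \<open>q\<close> on the right and \<open>p\<close> at the bottom: \<open>a\<close> is the pullback of \<open>q\<close> along \<open>p\<close>.\<close>

definition pullback_square :: "('o, 'a, 'x) cat_scheme \<Rightarrow> 'a \<Rightarrow> 'a \<Rightarrow> 'a \<Rightarrow> 'a \<Rightarrow> bool" where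
  "pullback_square C a q b p \<longleftrightarrow> square C a q b p \<and>
     (\<forall>z. \<forall>s\<in>Hom C z (Dom C p). \<forall>t\<in>Hom C z (Dom C q). p \<cdot>\<^bsub>C\<^esub> s = q \<cdot>\<^bsub>C\<^esub> t \<longrightarrow>
        (\<exists>!u. u \<in> Hom C z (Dom C a) \<and> a \<cdot>\<^bsub>C\<^esub> u = s \<and> b \<cdot>\<^bsub>C\<^esub> u = t))"

lemma pullback_lift:
  assumes "pullback_square C a q b p" "s \<in> Hom C z (Dom C p)" "t \<in> Hom C z (Dom C q)"
    "p \<cdot>\<^bsub>C\<^esub> s = q \<cdot>\<^bsub>C\<^esub> t"
  obtains u where "u \<in> Hom C z (Dom C a)" "a \<cdot>\<^bsub>C\<^esub> u = s" "b \<cdot>\<^bsub>C\<^esub> u = t"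
  using assms unfolding pullback_square_def by blast

lemma (in category) pullback_jointly_mono:
  assumes pb: "pullback_square C a q b p" and u: "u \<in> Hom C z (Dom C a)" "u' \<in> Hom C z (Dom C a)"
    and eq: "a \<cdot> u = a \<cdot> u'" "b \<cdot> u = b \<cdot> u'"
  shows "u = u'"
proof -
  have sq: "a \<in> Hom C (Dom C a) (Dom C p)" "b \<in> Hom C (Dom C a) (Dom C q)"
      "p \<in> Hom C (Dom C p) (Cod C p)" "q \<in> Hom C (Dom C q) (Cod C p)" "p \<cdot> a = q \<cdot> b"
    using pb by (auto simp: pullback_square_def square_def Hom_def)
  have "p \<cdot> (a \<cdot> u) = q \<cdot> (b \<cdot> u)"
    using Comp_assoc[OF u(1) sq(1,3)] Comp_assoc[OF u(1) sq(2,4)] sq(5) by simp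
  moreover have "a \<cdot> u \<in> Hom C z (Dom C p)" "b \<cdot> u \<in> Hom C z (Dom C q)"
    using Comp_Hom u(1) sq by blast+
  ultimately have "\<exists>!v. v \<in> Hom C z (Dom C a) \<and> a \<cdot> v = a \<cdot> u \<and> b \<cdot> v = b \<cdot> u"
    using pb unfolding pullback_square_def by blast
  then show ?thesis using u eq by metis
qed

lemma (in category) lifts_against_pullback:
  assumes pb: "pullback_square C a q b p" and q: "lifts_against C i q"
  shows "lifts_against C i a"
  unfolding lifts_against_def
proof (intro allI impI)
  fix u v assume uv: "square C i a u v"
  have sq: "a \<in> Hom C (Dom C a) (Dom C p)" "b \<in> Hom C (Dom C a) (Dom C q)"
      "p \<in> Hom C (Dom C p) (Cod C p)" "q \<in> Hom C (Dom C q) (Cod C p)" "p \<cdot> a = q \<cdot> b"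
    using pb by (auto simp: pullback_square_def square_def Hom_def)
  have i: "i \<in> Hom C (Dom C i) (Cod C i)" "u \<in> Hom C (Dom C i) (Dom C a)"
      "v \<in> Hom C (Cod C i) (Dom C p)" "v \<cdot> i = a \<cdot> u"
    using uv sq(1) by (auto simp: square_def Hom_def)
  have "(p \<cdot> v) \<cdot> i = q \<cdot> (b \<cdot> u)"
    using Comp_assoc[OF i(1,3) sq(3)] Comp_assoc[OF i(2) sq(1,3)] Comp_assoc[OF i(2) sq(2,4)]
      i(4) sq(5) by simp
  moreover have "b \<cdot> u \<in> Hom C (Dom C i) (Dom C q)" "p \<cdot> v \<in> Hom C (Cod C i) (Cod C p)"
    using Comp_Hom i sq by blast+
  ultimately have "square C i q (b \<cdot> u) (p \<cdot> v)"
    using i(1) sq(4) by (auto simp: square_def Hom_def)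
  then obtain h where h: "h \<in> Hom C (Cod C i) (Dom C q)" "h \<cdot> i = b \<cdot> u" "q \<cdot> h = p \<cdot> v"
    using q unfolding lifts_against_def by blast
  obtain k where k: "k \<in> Hom C (Cod C i) (Dom C a)" "a \<cdot> k = v" "b \<cdot> k = h"
    using pullback_lift[OF pb i(3) h(1)] h(3) by metis
  have "k \<cdot> i = u"
    by (rule pullback_jointly_mono[OF pb Comp_Hom[OF i(1) k(1)] i(2)])
      (simp_all add: Comp_assoc[OF i(1) k(1) sq(1), symmetric] Comp_assoc[OF i(1) k(1) sq(2), symmetric]
        k h(2) i(4))
  then show "\<exists>h\<in>Hom C (Cod C i) (Dom C a). h \<cdot> i = u \<and> a \<cdot> h = v"
    using k by blast
qed

text \<open>The induced maps into a pointwise pullback are automatically natural, as both sides of the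
  naturality equation have the same two projections.\<close>

lemma functor_pullback_lift:
  assumes a: "nat_trans J C P A a" and b: "nat_trans J C P B b"
    and p: "nat_trans J C A K p" and q: "nat_trans J C B K q"
    and pb: "\<And>x. x \<in> Obj J \<Longrightarrow> pullback_square C (a x) (q x) (b x) (p x)"
    and s: "nat_trans J C D A s" and t: "nat_trans J C D B t"
    and eq: "\<And>x. x \<in> Obj J \<Longrightarrow> p x \<cdot>\<^bsub>C\<^esub> s x = q x \<cdot>\<^bsub>C\<^esub> t x"
  obtains u where "nat_trans J C D P u"
    "\<And>x. x \<in> Obj J \<Longrightarrow> a x \<cdot>\<^bsub>C\<^esub> u x = s x" "\<And>x. x \<in> Obj J \<Longrightarrow> b x \<cdot>\<^bsub>C\<^esub> u x = t x"
proof -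
  interpret a: nat_trans J C P A a by fact
  interpret b: nat_trans J C P B b by fact
  interpret p: nat_trans J C A K p by fact
  interpret q: nat_trans J C B K q by fact
  interpret s: nat_trans J C D A s by fact
  interpret t: nat_trans J C D B t by fact
  have "\<exists>u. u \<in> Hom C (FObj D x) (FObj P x) \<and> a x \<cdot>\<^bsub>C\<^esub> u = s x \<and> b x \<cdot>\<^bsub>C\<^esub> u = t x"
    if x: "x \<in> Obj J" for x
    using pullback_lift[OF pb[OF x], of "s x" "FObj D x" "t x"] eq[OF x] s.component[OF x]
      t.component[OF x] Hom_D(2)[OF p.component[OF x]] Hom_D(2)[OF q.component[OF x]]
      Hom_D(2)[OF a.component[OF x]] by metis
  then obtain u where u: "\<And>x. x \<in> Obj J \<Longrightarrow>
      u x \<in> Hom C (FObj D x) (FObj P x) \<and> a x \<cdot>\<^bsub>C\<^esub> u x = s x \<and> b x \<cdot>\<^bsub>C\<^esub> u x = t x"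
    by metis
  note assoc = a.F.C.Comp_assoc
  have "nat_trans J C D P u"
  proof (rule nat_transI[OF s.F.is_functor_axioms a.F.is_functor_axioms])
    fix x assume "x \<in> Obj J" then show "u x \<in> Hom C (FObj D x) (FObj P x)" using u by blast
  next
    fix x y f assume f: "f \<in> Hom J x y" and x: "x \<in> Obj J" and y: "y \<in> Obj J"
    note ux = conjunct1[OF u[OF x]] and uy = conjunct1[OF u[OF y]]
    note Df = s.F.FArr_Hom[OF f] and Pf = a.F.FArr_Hom[OF f]
    have dom: "Dom C (a y) = FObj P y" using Hom_D(2)[OF a.component[OF y]] .
    show "u y \<cdot>\<^bsub>C\<^esub> FArr D f = FArr P f \<cdot>\<^bsub>C\<^esub> u x"
    proof (rule a.F.C.pullback_jointly_mono[OF pb[OF y], of _ "FObj D x"])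
      show "u y \<cdot>\<^bsub>C\<^esub> FArr D f \<in> Hom C (FObj D x) (Dom C (a y))"
        "FArr P f \<cdot>\<^bsub>C\<^esub> u x \<in> Hom C (FObj D x) (Dom C (a y))"
        unfolding dom using ux uy Df Pf a.F.C.Comp_Hom by blast+
      show "a y \<cdot>\<^bsub>C\<^esub> (u y \<cdot>\<^bsub>C\<^esub> FArr D f) = a y \<cdot>\<^bsub>C\<^esub> (FArr P f \<cdot>\<^bsub>C\<^esub> u x)"
        using assoc[OF Df uy a.component[OF y]] assoc[OF ux Pf a.component[OF y]]
          assoc[OF ux a.component[OF x] a.G.FArr_Hom[OF f]]
          u[OF x] u[OF y] s.naturality[OF f] a.naturality[OF f] by simp
      show "b y \<cdot>\<^bsub>C\<^esub> (u y \<cdot>\<^bsub>C\<^esub> FArr D f) = b y \<cdot>\<^bsub>C\<^esub> (FArr P f \<cdot>\<^bsub>C\<^esub> u x)"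
        using assoc[OF Df uy b.component[OF y]] assoc[OF ux Pf b.component[OF y]]
          assoc[OF ux b.component[OF x] b.G.FArr_Hom[OF f]]
          u[OF x] u[OF y] t.naturality[OF f] b.naturality[OF f] by simp
    qed
  qed
  then show thesis using that u by blast
qed

text \<open>Pullbacks of functors are computed pointwise. The squares are chosen independently for
  different \<open>x\<close>; uniqueness of induced maps makes the choices functorial.\<close>

lemma functor_pullback:
  assumes p: "nat_trans J C A K p" and q: "nat_trans J C B K q"
    and ex: "\<And>x. x \<in> Obj J \<Longrightarrow> \<exists>a b. pullback_square C a (q x) b (p x)"
  obtains P a b where "nat_trans J C P A a" "nat_trans J C P B b"
    "\<And>x. x \<in> Obj J \<Longrightarrow> pullback_square C (a x) (q x) (b x) (p x)"
proof -
  interpret p: nat_trans J C A K p by fact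
  interpret q: nat_trans J C B K q by fact
  note assoc = p.F.C.Comp_assoc
  obtain a b where pb: "\<And>x. x \<in> Obj J \<Longrightarrow> pullback_square C (a x) (q x) (b x) (p x)"
    using ex by metis
  have ab: "a x \<in> Hom C (Dom C (a x)) (FObj A x)" "b x \<in> Hom C (Dom C (a x)) (FObj B x)"
    "p x \<cdot>\<^bsub>C\<^esub> a x = q x \<cdot>\<^bsub>C\<^esub> b x" if x: "x \<in> Obj J" for x
    using pb[OF x] p.component[OF x] q.component[OF x]
    by (auto simp: pullback_square_def square_def Hom_def)
  \<comment> \<open>\<open>u\<close> is the map of fibre products induced by \<open>f\<close>.\<close>
  define is_map where "is_map f u \<longleftrightarrow> u \<in> Hom C (Dom C (a (Dom J f))) (Dom C (a (Cod J f))) \<and>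
     a (Cod J f) \<cdot>\<^bsub>C\<^esub> u = FArr A f \<cdot>\<^bsub>C\<^esub> a (Dom J f) \<and>
     b (Cod J f) \<cdot>\<^bsub>C\<^esub> u = FArr B f \<cdot>\<^bsub>C\<^esub> b (Dom J f)" for f u
  have is_map: "is_map f u \<longleftrightarrow> u \<in> Hom C (Dom C (a x)) (Dom C (a y)) \<and>
     a y \<cdot>\<^bsub>C\<^esub> u = FArr A f \<cdot>\<^bsub>C\<^esub> a x \<and> b y \<cdot>\<^bsub>C\<^esub> u = FArr B f \<cdot>\<^bsub>C\<^esub> b x"
    if "f \<in> Hom J x y" for f u x y
    using that by (simp add: is_map_def Hom_def)
  have uniq: "u = u'" if f: "f \<in> Hom J x y" and "is_map f u" "is_map f u'" for f x y u u'
    using that(2,3) p.F.C.pullback_jointly_mono[OF pb[OF p.F.J.Hom_Obj(2)[OF f]]]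
    unfolding is_map[OF f] by metis
  have ex_map: "\<exists>u. is_map f u" if f: "f \<in> Hom J x y" for f x y
  proof -
    note x = p.F.J.Hom_Obj(1)[OF f] and y = p.F.J.Hom_Obj(2)[OF f]
    note Af = p.F.FArr_Hom[OF f] and Bf = q.F.FArr_Hom[OF f] and Kf = p.G.FArr_Hom[OF f]
    note abx = ab[OF x]
    have "p y \<cdot>\<^bsub>C\<^esub> (FArr A f \<cdot>\<^bsub>C\<^esub> a x) = FArr K f \<cdot>\<^bsub>C\<^esub> (p x \<cdot>\<^bsub>C\<^esub> a x)"
      using assoc[OF abx(1) Af p.component[OF y]] assoc[OF abx(1) p.component[OF x] Kf]
        p.naturality[OF f] by simp
    moreover have "q y \<cdot>\<^bsub>C\<^esub> (FArr B f \<cdot>\<^bsub>C\<^esub> b x) = FArr K f \<cdot>\<^bsub>C\<^esub> (q x \<cdot>\<^bsub>C\<^esub> b x)"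
      using assoc[OF abx(2) Bf q.component[OF y]] assoc[OF abx(2) q.component[OF x] Kf]
        q.naturality[OF f] by simp
    ultimately have eq: "p y \<cdot>\<^bsub>C\<^esub> (FArr A f \<cdot>\<^bsub>C\<^esub> a x) = q y \<cdot>\<^bsub>C\<^esub> (FArr B f \<cdot>\<^bsub>C\<^esub> b x)"
      using abx(3) by simp
    show ?thesis
      using pullback_lift[OF pb[OF y] _ _ eq, of "Dom C (a x)"]
        p.F.C.Comp_Hom[OF abx(1) Af] p.F.C.Comp_Hom[OF abx(2) Bf]
        Hom_D(2)[OF p.component[OF y]] Hom_D(2)[OF q.component[OF y]]
      unfolding is_map[OF f] by metis
  qed
  define P where "P = \<lparr>FObj = (\<lambda>x. Dom C (a x)), FArr = (\<lambda>f. SOME u. is_map f u)\<rparr>"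
  have PO: "FObj P x = Dom C (a x)" for x by (simp add: P_def)
  have PA: "is_map f (FArr P f)" if "f \<in> Hom J x y" for f x y
    using ex_map[OF that] by (simp add: P_def someI_ex)
  have PA_eq: "FArr P f = u" if "f \<in> Hom J x y" "is_map f u" for f x y u
    using uniq[OF that(1) PA[OF that(1)] that(2)] .
  have P: "is_functor J C P"
  proof unfold_locales
    fix x assume x: "x \<in> Obj J"
    note abx = ab[OF x]
    show PC: "FObj P x \<in> Obj C" using p.F.C.Hom_Obj(1)[OF abx(1)] by (simp add: PO)
    have "is_map (Ident J x) (Ident C (FObj P x))"
      unfolding is_map[OF p.F.J.Ident_Hom[OF x]] p.F.FArr_Ident[OF x] q.F.FArr_Ident[OF x]
      using p.F.C.Ident_Hom[OF PC] p.F.C.Comp_Ident[OF abx(1)] p.F.C.Comp_Ident[OF abx(2)]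
        p.F.C.Ident_Comp[OF abx(1)] p.F.C.Ident_Comp[OF abx(2)]
      by (simp add: PO)
    then show "FArr P (Ident J x) = Ident C (FObj P x)"
      by (rule PA_eq[OF p.F.J.Ident_Hom[OF x]])
  next
    fix x y f assume f: "f \<in> Hom J x y"
    show "FArr P f \<in> Hom C (FObj P x) (FObj P y)"
      using PA[OF f] unfolding is_map[OF f] PO by blast
  next
    fix x y z f g assume f: "f \<in> Hom J x y" and g: "g \<in> Hom J y z"
    note x = p.F.J.Hom_Obj(1)[OF f] and y = p.F.J.Hom_Obj(1)[OF g] and z = p.F.J.Hom_Obj(2)[OF g]
    note mf = PA[OF f, unfolded is_map[OF f]] and mg = PA[OF g, unfolded is_map[OF g]]
    note hf = conjunct1[OF mf] and hg = conjunct1[OF mg]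
    have "is_map (g \<cdot>\<^bsub>J\<^esub> f) (FArr P g \<cdot>\<^bsub>C\<^esub> FArr P f)"
      unfolding is_map[OF p.F.J.Comp_Hom[OF f g]]
    proof (intro conjI)
      show "FArr P g \<cdot>\<^bsub>C\<^esub> FArr P f \<in> Hom C (Dom C (a x)) (Dom C (a z))"
        using mf mg p.F.C.Comp_Hom by blast
      show "a z \<cdot>\<^bsub>C\<^esub> (FArr P g \<cdot>\<^bsub>C\<^esub> FArr P f) = FArr A (g \<cdot>\<^bsub>J\<^esub> f) \<cdot>\<^bsub>C\<^esub> a x"
        using assoc[OF hf hg ab(1)[OF z]] assoc[OF hf ab(1)[OF y] p.F.FArr_Hom[OF g]]
          assoc[OF ab(1)[OF x] p.F.FArr_Hom[OF f] p.F.FArr_Hom[OF g]] mf mg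
        by (simp add: p.F.FArr_Comp[OF f g])
      show "b z \<cdot>\<^bsub>C\<^esub> (FArr P g \<cdot>\<^bsub>C\<^esub> FArr P f) = FArr B (g \<cdot>\<^bsub>J\<^esub> f) \<cdot>\<^bsub>C\<^esub> b x"
        using assoc[OF hf hg ab(2)[OF z]] assoc[OF hf ab(2)[OF y] q.F.FArr_Hom[OF g]]
          assoc[OF ab(2)[OF x] q.F.FArr_Hom[OF f] q.F.FArr_Hom[OF g]] mf mg
        by (simp add: q.F.FArr_Comp[OF f g])
    qed
    then show "FArr P (g \<cdot>\<^bsub>J\<^esub> f) = FArr P g \<cdot>\<^bsub>C\<^esub> FArr P f"
      by (rule PA_eq[OF p.F.J.Comp_Hom[OF f g]])
  qed
  have "nat_trans J C P A a" "nat_trans J C P B b"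
    using PA is_map ab
    by (auto intro!: nat_transI[OF P p.F.is_functor_axioms] nat_transI[OF P q.F.is_functor_axioms]
        simp: PO)
  then show thesis using that pb by blast
qed


lemma pullback_square_sym:
  assumes "pullback_square C a q b p"
  shows "pullback_square C b p a q"
proof -
  have sq: "square C a q b p" and
    lift: "\<And>z s t. s \<in> Hom C z (Dom C p) \<Longrightarrow> t \<in> Hom C z (Dom C q) \<Longrightarrow> p \<cdot>\<^bsub>C\<^esub> s = q \<cdot>\<^bsub>C\<^esub> t \<Longrightarrow>
        \<exists>!u. u \<in> Hom C z (Dom C a) \<and> a \<cdot>\<^bsub>C\<^esub> u = s \<and> b \<cdot>\<^bsub>C\<^esub> u = t"
    using assms unfolding pullback_square_def by blast+
  have "square C b p a q" and dom: "Dom C b = Dom C a"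
    using sq by (auto simp: square_def Hom_def)
  moreover have "\<exists>!u. u \<in> Hom C z (Dom C b) \<and> b \<cdot>\<^bsub>C\<^esub> u = s \<and> a \<cdot>\<^bsub>C\<^esub> u = t"
    if "s \<in> Hom C z (Dom C q)" "t \<in> Hom C z (Dom C p)" "q \<cdot>\<^bsub>C\<^esub> s = p \<cdot>\<^bsub>C\<^esub> t" for z s t
    using lift[OF that(2,1) that(3)[symmetric]] unfolding dom by (simp add: conj_commute)
  ultimately show ?thesis unfolding pullback_square_def by blast
qed

text \<open>The walking cospan \<open>a \<rightarrow> c \<leftarrow> b\<close> with non-identity arrows \<open>d\<close> and \<open>e\<close>. Objects and arrows have
  the same type, so each object serves as its own identity arrow.\<close>

definition cospan_cat :: "'u \<Rightarrow> 'u \<Rightarrow> 'u \<Rightarrow> 'u \<Rightarrow> 'u \<Rightarrow> ('u, 'u) cat" where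
  "cospan_cat a b c d e = \<lparr>Obj = {a, b, c}, Arr = {a, b, c, d, e},
     Dom = (\<lambda>f. if f = d then a else if f = e then b else f),
     Cod = (\<lambda>f. if f = d \<or> f = e then c else f),
     Ident = (\<lambda>x. x), Comp = (\<lambda>g f. if f \<in> {a, b, c} then g else f)\<rparr>"

lemma size_cardinal_finite:
  assumes "size_cardinal \<kappa>" "finite A"
  shows "small \<kappa> A"
  using assms finite_iff_ordLess_natLeq ordLess_transitive
  unfolding size_cardinal_def small_def by blast

lemma size_cardinal_infinite:
  assumes "size_cardinal (\<kappa> :: 'u rel)"
  shows "infinite (UNIV :: 'u set)"
proof
  assume "finite (UNIV :: 'u set)"
  then have "finite (Field \<kappa>)" by (rule finite_subset[OF subset_UNIV])
  then have "|Field \<kappa>| <o natLeq" using finite_iff_ordLess_natLeq by blast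
  moreover have "|Field \<kappa>| =o \<kappa>"
    using assms by (simp add: size_cardinal_def card_of_Field_ordIso)
  ultimately have "\<kappa> <o natLeq" using ordIso_ordLess_trans ordIso_symmetric by blast
  then show False
    using assms ordLess_transitive ordLess_irreflexive unfolding size_cardinal_def by blast
qed

text \<open>The index categories in \<open>has_small_limits\<close> live on the type of \<open>\<kappa>\<close>. That type is infinite
  because \<open>\<kappa>\<close> is, hence it has room for the five arrows of a cospan.\<close>

lemma small_limits_imp_pullback:
  fixes \<kappa> :: "'u rel"
  assumes \<kappa>: "size_cardinal \<kappa>" and cat: "category C" and lim: "has_small_limits \<kappa> C"
    and p: "p \<in> Hom C x k" and q: "q \<in> Hom C y k"
  shows "\<exists>a b. pullback_square C a q b p"
proof -
  interpret C: category C by fact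
  obtain e :: "nat \<Rightarrow> 'u" where e: "inj e"
    using size_cardinal_infinite[OF \<kappa>] infinite_countable_subset by blast
  note [simp] = inj_eq[OF e]
  define J where "J = cospan_cat (e 0) (e 1) (e 2) (e 3) (e 4)"
  define D :: "('u, 'u, _, _) fctr" where
    "D = \<lparr>FObj = (\<lambda>i. if i = e 0 then x else if i = e 1 then y else k),
      FArr = (\<lambda>f. if f = e 0 then Ident C x else if f = e 1 then Ident C y else
        if f = e 2 then Ident C k else if f = e 3 then p else q)\<rparr>"
  note obj = C.Hom_Obj[OF p] C.Hom_Obj[OF q]
  note ids = C.Ident_Hom[OF obj(1)] C.Ident_Hom[OF obj(3)] C.Ident_Hom[OF obj(2)]
  note laws = C.Comp_Ident[OF p] C.Comp_Ident[OF q] C.Ident_Comp[OF p] C.Ident_Comp[OF q]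
    C.Comp_Ident[OF ids(1)] C.Comp_Ident[OF ids(2)] C.Comp_Ident[OF ids(3)]
  have J: "category J"
    by unfold_locales (auto simp: J_def cospan_cat_def Hom_def split: if_splits)
  have JHom: "f \<in> Hom J i j \<longleftrightarrow> (f = i \<and> f = j \<and> f \<in> {e 0, e 1, e 2}) \<or>
      (f = e 3 \<and> i = e 0 \<and> j = e 2) \<or> (f = e 4 \<and> i = e 1 \<and> j = e 2)" for f i j
    by (auto simp: J_def cospan_cat_def Hom_def)
  have JObj: "Obj J = {e 0, e 1, e 2}" by (simp add: J_def cospan_cat_def)
  have "is_functor J C D"
  proof (intro is_functor.intro is_functor_axioms.intro J cat)
    show "FObj D i \<in> Obj C" if "i \<in> Obj J" for i
      using that obj by (auto simp: D_def JObj)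
    show "FArr D f \<in> Hom C (FObj D i) (FObj D j)" if "f \<in> Hom J i j" for f i j
      using that ids p q unfolding JHom by (auto simp: D_def)
    show "FArr D (Ident J i) = Ident C (FObj D i)" if "i \<in> Obj J" for i
      using that unfolding JObj by (auto simp: D_def J_def cospan_cat_def)
    show "FArr D (g \<cdot>\<^bsub>J\<^esub> f) = FArr D g \<cdot>\<^bsub>C\<^esub> FArr D f" if "f \<in> Hom J i j" "g \<in> Hom J j l" for f g i j l
      using that laws unfolding JHom by (auto simp: D_def J_def cospan_cat_def)
  qed
  moreover have "small \<kappa> (Obj J)" "small \<kappa> (Arr J)"
    by (simp_all add: J_def cospan_cat_def size_cardinal_finite[OF \<kappa>])
  ultimately obtain L \<pi> where L: "is_limit C J D L \<pi>"
    using lim unfolding has_small_limits_def by blast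
  then have cone: "is_cone C J D L \<pi>" and univ: "\<And>L' \<pi>'. is_cone C J D L' \<pi>' \<Longrightarrow>
        \<exists>!u. u \<in> Hom C L' L \<and> (\<forall>j\<in>Obj J. \<pi> j \<cdot>\<^bsub>C\<^esub> u = \<pi>' j)"
    unfolding is_limit_def by blast+
  have \<pi>: "\<pi> (e 0) \<in> Hom C L x" "\<pi> (e 1) \<in> Hom C L y"
    using cone unfolding is_cone_def JObj by (auto simp: D_def)
  have "FArr D f \<cdot>\<^bsub>C\<^esub> \<pi> i = \<pi> j" if "f \<in> Hom J i j" for f i j
    using cone that unfolding is_cone_def by blast
  from this[of "e 3" "e 0" "e 2"] this[of "e 4" "e 1" "e 2"]
  have comm: "p \<cdot>\<^bsub>C\<^esub> \<pi> (e 0) = \<pi> (e 2)" "q \<cdot>\<^bsub>C\<^esub> \<pi> (e 1) = \<pi> (e 2)"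
    by (simp_all add: D_def JHom)
  have "pullback_square C (\<pi> (e 0)) q (\<pi> (e 1)) p"
    unfolding pullback_square_def
  proof (intro conjI allI ballI impI)
    show "square C (\<pi> (e 0)) q (\<pi> (e 1)) p"
      using \<pi> p q comm by (auto simp: square_def Hom_def)
  next
    fix z s t assume "s \<in> Hom C z (Dom C p)" "t \<in> Hom C z (Dom C q)"
      and eq: "p \<cdot>\<^bsub>C\<^esub> s = q \<cdot>\<^bsub>C\<^esub> t"
    then have s: "s \<in> Hom C z x" and t: "t \<in> Hom C z y" using p q by (auto simp: Hom_def)
    \<comment> \<open>The leg of a cone at the vertex of the cospan is determined by the other two.\<close>
    define \<pi>' where "\<pi>' j = (if j = e 0 then s else if j = e 1 then t else p \<cdot>\<^bsub>C\<^esub> s)" for j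
    have "is_cone C J D z \<pi>'"
      using C.Hom_Obj[OF s] s t C.Comp_Hom[OF s p] eq C.Ident_Comp[OF s] C.Ident_Comp[OF t]
        C.Ident_Comp[OF C.Comp_Hom[OF s p]]
      unfolding is_cone_def JObj Ball_def JHom by (auto simp: D_def \<pi>'_def)
    from univ[OF this] have *: "\<exists>!u. u \<in> Hom C z L \<and> \<pi> (e 0) \<cdot>\<^bsub>C\<^esub> u = s \<and> \<pi> (e 1) \<cdot>\<^bsub>C\<^esub> u = t \<and>
        \<pi> (e 2) \<cdot>\<^bsub>C\<^esub> u = p \<cdot>\<^bsub>C\<^esub> s"
      by (simp add: JObj \<pi>'_def)
    have "\<pi> (e 2) \<cdot>\<^bsub>C\<^esub> u = p \<cdot>\<^bsub>C\<^esub> s" if "u \<in> Hom C z L" "\<pi> (e 0) \<cdot>\<^bsub>C\<^esub> u = s" for u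
      using C.Comp_assoc[OF that(1) \<pi>(1) p] that(2) comm(1) by simp
    then show "\<exists>!u. u \<in> Hom C z (Dom C (\<pi> (e 0))) \<and> \<pi> (e 0) \<cdot>\<^bsub>C\<^esub> u = s \<and> \<pi> (e 1) \<cdot>\<^bsub>C\<^esub> u = t"
      using * unfolding Hom_D(2)[OF \<pi>(1)] by metis
  qed
  then show ?thesis by blast
qed

definition terminal :: "('o, 'a, 'x) cat_scheme \<Rightarrow> 'o \<Rightarrow> bool" where
  "terminal C t \<longleftrightarrow> t \<in> Obj C \<and> (\<forall>x\<in>Obj C. \<exists>!u. u \<in> Hom C x t)"

lemma terminal_unique:
  "terminal C t \<Longrightarrow> category C \<Longrightarrow> u \<in> Hom C x t \<Longrightarrow> v \<in> Hom C x t \<Longrightarrow> u = v"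
  unfolding terminal_def using category.Hom_Obj(1) by metis

lemma small_limits_imp_terminal:
  fixes \<kappa> :: "'u rel"
  assumes \<kappa>: "size_cardinal \<kappa>" and cat: "category C" and lim: "has_small_limits \<kappa> C"
  shows "\<exists>t. terminal C t"
proof -
  interpret C: category C by fact
  define J :: "('u, 'u) cat" where
    "J = \<lparr>Obj = {}, Arr = {}, Dom = (\<lambda>x. x), Cod = (\<lambda>x. x), Ident = (\<lambda>x. x), Comp = (\<lambda>g f. f)\<rparr>"
  have "is_functor J C D" for D
    by unfold_locales (auto simp: J_def Hom_def)
  moreover have "small \<kappa> (Obj J)" "small \<kappa> (Arr J)"
    using size_cardinal_finite[OF \<kappa>] by (auto simp: J_def)
  \<comment> \<open>Any record is a functor on the empty category, so an arbitrary one can be used.\<close>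
  ultimately obtain L \<pi> where "is_limit C J undefined L \<pi>"
    using lim unfolding has_small_limits_def by blast
  moreover have "is_cone C J undefined x \<pi>' \<longleftrightarrow> x \<in> Obj C" for x \<pi>'
    by (auto simp: is_cone_def J_def Hom_def)
  ultimately have "terminal C L"
    by (auto simp: is_limit_def terminal_def J_def)
  then show ?thesis by blast
qed

lemma nat_trans_to_terminal:
  assumes F: "is_functor J C F" and t: "terminal C t"
  obtains u where "nat_trans J C F (const_fctr C t) u"
proof -
  interpret F: is_functor J C F by fact
  have "t \<in> Obj C" using t by (simp add: terminal_def)
  then have c: "is_functor J C (const_fctr C t)"
    by (rule is_functor_const[OF F.J.category_axioms F.C.category_axioms])
  interpret c: is_functor J C "const_fctr C t" by fact
  have "\<exists>u. u \<in> Hom C (FObj F x) t" if "x \<in> Obj J" for x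
    using t F.FObj_Obj[OF that] unfolding terminal_def by blast
  then obtain u where u: "\<And>x. x \<in> Obj J \<Longrightarrow> u x \<in> Hom C (FObj F x) t"
    by metis
  have "nat_trans J C F (const_fctr C t) u"
  proof (rule nat_transI[OF F c])
    fix x y f assume f: "f \<in> Hom J x y" and x: "x \<in> Obj J" and y: "y \<in> Obj J"
    have "u y \<cdot>\<^bsub>C\<^esub> FArr F f \<in> Hom C (FObj F x) t"
      by (rule F.C.Comp_Hom[OF F.FArr_Hom[OF f] u[OF y]])
    moreover have "FArr (const_fctr C t) f \<cdot>\<^bsub>C\<^esub> u x \<in> Hom C (FObj F x) t"
      using F.C.Comp_Hom[OF u[OF x]] c.FArr_Hom[OF f] by simp
    ultimately show "u y \<cdot>\<^bsub>C\<^esub> FArr F f = FArr (const_fctr C t) f \<cdot>\<^bsub>C\<^esub> u x"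
      by (rule terminal_unique[OF t F.C.category_axioms])
  qed (simp add: u)
  then show thesis by (rule that)
qed


section \<open>Fibrations\<close>

context category
begin

text \<open>The retract argument: if \<open>p = R \<cdot> L\<close> and \<open>L\<close> lifts against \<open>p\<close>, then a lift \<open>h\<close> in the square
  with sides \<open>L\<close>, \<open>p\<close>, \<open>Ident\<close> and \<open>R\<close> exhibits \<open>p\<close> as a retract of \<open>R\<close>.\<close>

lemma retract_argument:
  assumes L: "L \<in> Hom C x y" and R: "R \<in> Hom C y z" and lift: "lifts_against C L (R \<cdot> L)"
  shows "arrow_retract C (R \<cdot> L) R"
proof -
  note RL = Comp_Hom[OF L R]
  have id: "Ident C x \<in> Hom C x x" "Ident C z \<in> Hom C z z"
    using Hom_Obj[OF RL] Ident_Hom by blast+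
  have "square C L (R \<cdot> L) (Ident C x) R"
    using L R RL id Comp_Ident[OF RL] by (auto simp: square_def Hom_def)
  then obtain h where h: "h \<in> Hom C y x" "h \<cdot> L = Ident C x" "(R \<cdot> L) \<cdot> h = R"
    using lift L RL unfolding lifts_against_def by (auto simp: Hom_def)
  have "square C (R \<cdot> L) R L (Ident C z)" "square C R (R \<cdot> L) h (Ident C z)"
    using L R RL id h Ident_Comp[OF RL] Ident_Comp[OF R] by (auto simp: square_def Hom_def)
  moreover have "Ident C z \<cdot> Ident C z = Ident C z" by (rule Comp_Ident[OF id(2)])
  ultimately show ?thesis
    using h(2) RL unfolding arrow_retract_def by (auto simp: Hom_def)
qed

lemma lifts_against_Comp:
  assumes p: "p \<in> Hom C x y" and q: "q \<in> Hom C y z"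
    and lp: "lifts_against C i p" and lq: "lifts_against C i q"
  shows "lifts_against C i (q \<cdot> p)"
  unfolding lifts_against_def
proof (intro allI impI)
  fix u v assume "square C i (q \<cdot> p) u v"
  then have i: "i \<in> Hom C (Dom C i) (Cod C i)" and u: "u \<in> Hom C (Dom C i) x"
    and v: "v \<in> Hom C (Cod C i) z" and eq: "v \<cdot> i = (q \<cdot> p) \<cdot> u"
    using Comp_Hom[OF p q] by (auto simp: square_def Hom_def)
  have "square C i q (p \<cdot> u) v"
    using i q v eq Comp_Hom[OF u p] Comp_assoc[OF u p q] by (auto simp: square_def Hom_def)
  then obtain h where h: "h \<in> Hom C (Cod C i) y" "h \<cdot> i = p \<cdot> u" "q \<cdot> h = v"
    using lq q unfolding lifts_against_def by (auto simp: Hom_def)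
  have "square C i p u h"
    using i p u h by (auto simp: square_def Hom_def)
  then obtain k where k: "k \<in> Hom C (Cod C i) x" "k \<cdot> i = u" "p \<cdot> k = h"
    using lp p unfolding lifts_against_def by (auto simp: Hom_def)
  then have "(q \<cdot> p) \<cdot> k = v" using Comp_assoc[OF k(1) p q] h(3) by simp
  then show "\<exists>h\<in>Hom C (Cod C i) (Dom C (q \<cdot> p)). h \<cdot> i = u \<and> (q \<cdot> p) \<cdot> h = v"
    using k Hom_D(2)[OF Comp_Hom[OF p q]] by auto
qed

lemma lifts_against_Ident:
  assumes "x \<in> Obj C"
  shows "lifts_against C i (Ident C x)"
  unfolding lifts_against_def
proof (intro allI impI)
  fix u v assume "square C i (Ident C x) u v"
  then have u: "u \<in> Hom C (Dom C i) x" and v: "v \<in> Hom C (Cod C i) x"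
    and eq: "v \<cdot> i = Ident C x \<cdot> u"
    using Ident_Hom[OF assms] by (auto simp: square_def Hom_def)
  then show "\<exists>h\<in>Hom C (Cod C i) (Dom C (Ident C x)). h \<cdot> i = u \<and> Ident C x \<cdot> h = v"
    using Ident_Comp[OF u] Ident_Comp[OF v] Ident_Hom[OF assms] by (auto simp: Hom_def)
qed

end

context model_category
begin

text \<open>Being characterized by a right lifting property, fibrations and trivial fibrations are closed
  under composition and pullback.\<close>

lemma Fib_iff_lifts:
  assumes p: "p \<in> Arr M"
  shows "p \<in> Fib M \<longleftrightarrow> (\<forall>i \<in> Cof M \<inter> Weq M. lifts_against M i p)"
proof
  assume lift: "\<forall>i \<in> Cof M \<inter> Weq M. lifts_against M i p"
  obtain L R E where "functorial_factorization M L R E"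
    and LR: "\<forall>f\<in>Arr M. L f \<in> Cof M \<inter> Weq M \<and> R f \<in> Fib M"
    using factor_trivial_cofibration by blast
  then have "L p \<in> Hom M (Dom M p) (Cod M (L p))" "R p \<in> Hom M (Cod M (L p)) (Cod M p)"
      and eq: "R p \<cdot> L p = p"
    using p unfolding functorial_factorization_def by (auto simp: Hom_def)
  from retract_argument[OF this(1,2)] have "arrow_retract M p (R p)"
    using lift LR p unfolding eq by blast
  then show "p \<in> Fib M" using LR p retracts(3) unfolding closed_under_retracts_def by blast
qed (use lift_trivial_cofibration in blast)

lemma trivial_Fib_iff_lifts:
  assumes p: "p \<in> Arr M"
  shows "p \<in> Fib M \<inter> Weq M \<longleftrightarrow> (\<forall>i \<in> Cof M. lifts_against M i p)"
proof
  assume lift: "\<forall>i \<in> Cof M. lifts_against M i p"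
  obtain L R E where "functorial_factorization M L R E"
    and LR: "\<forall>f\<in>Arr M. L f \<in> Cof M \<and> R f \<in> Fib M \<inter> Weq M"
    using factor_trivial_fibration by blast
  then have "L p \<in> Hom M (Dom M p) (Cod M (L p))" "R p \<in> Hom M (Cod M (L p)) (Cod M p)"
      and eq: "R p \<cdot> L p = p"
    using p unfolding functorial_factorization_def by (auto simp: Hom_def)
  from retract_argument[OF this(1,2)] have "arrow_retract M p (R p)"
    using lift LR p unfolding eq by blast
  then show "p \<in> Fib M \<inter> Weq M"
    using LR p retracts(1,3) unfolding closed_under_retracts_def by blast
qed (use lift_trivial_fibration in blast)

lemma Fib_Comp:
  assumes "p \<in> Hom M x y" "q \<in> Hom M y z" "p \<in> Fib M" "q \<in> Fib M"
  shows "q \<cdot> p \<in> Fib M"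
  using assms lifts_against_Comp[OF assms(1,2)] Fib_iff_lifts Hom_D(1) Comp_Hom by metis

lemma trivial_Fib_Comp:
  assumes "p \<in> Hom M x y" "q \<in> Hom M y z" "p \<in> Fib M \<inter> Weq M" "q \<in> Fib M \<inter> Weq M"
  shows "q \<cdot> p \<in> Fib M \<inter> Weq M"
  using assms lifts_against_Comp[OF assms(1,2)] trivial_Fib_iff_lifts Hom_D(1) Comp_Hom by metis

lemma Fib_pullback:
  assumes "pullback_square M a q b p" "q \<in> Fib M"
  shows "a \<in> Fib M"
proof -
  have "a \<in> Arr M" "q \<in> Arr M" using assms(1) by (auto simp: pullback_square_def square_def)
  then show ?thesis using assms lifts_against_pullback Fib_iff_lifts by blast
qed

lemma trivial_Fib_pullback:
  assumes "pullback_square M a q b p" "q \<in> Fib M \<inter> Weq M"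
  shows "a \<in> Fib M \<inter> Weq M"
proof -
  have "a \<in> Arr M" "q \<in> Arr M" using assms(1) by (auto simp: pullback_square_def square_def)
  then show ?thesis using assms lifts_against_pullback trivial_Fib_iff_lifts by blast
qed

lemma Ident_trivial_Fib: "x \<in> Obj M \<Longrightarrow> Ident M x \<in> Fib M \<inter> Weq M"
  using trivial_Fib_iff_lifts lifts_against_Ident Hom_D(1) Ident_Hom by metis

lemma Weq_cancel_right:
  assumes "f \<in> Hom M x y" "g \<in> Hom M y z" "f \<in> Weq M" "g \<cdot> f \<in> Weq M"
  shows "g \<in> Weq M"
  using assms two_of_three unfolding two_out_of_three_def by blast

lemma Weq_Comp:
  assumes "f \<in> Hom M x y" "g \<in> Hom M y z" "f \<in> Weq M" "g \<in> Weq M"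
  shows "g \<cdot> f \<in> Weq M"
  using assms two_of_three unfolding two_out_of_three_def by blast

end


section \<open>Spans of trivial fibrations\<close>

definition trivial_fibration ::
  "('j, 'k, 'z) cat_scheme \<Rightarrow> ('o, 'a, 'x) model_cat_scheme \<Rightarrow>
   ('j, 'k, 'o, 'a) fctr \<Rightarrow> ('j, 'k, 'o, 'a) fctr \<Rightarrow> ('j \<Rightarrow> 'a) \<Rightarrow> bool" where
  "trivial_fibration J M F G t \<longleftrightarrow> nat_trans J M F G t \<and> (\<forall>x\<in>Obj J. t x \<in> Fib M \<inter> Weq M)"

text \<open>A replacement for \<open>weakly_equivalent\<close> in which the zig-zag has length two and its maps can be
  pulled back.\<close>

definition trivial_fibration_span ::
  "('j, 'k, 'z) cat_scheme \<Rightarrow> ('o, 'a, 'x) model_cat_scheme \<Rightarrow>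
   ('j, 'k, 'o, 'a) fctr \<Rightarrow> ('j, 'k, 'o, 'a) fctr \<Rightarrow> bool" where
  "trivial_fibration_span J M A B \<longleftrightarrow>
     (\<exists>T p q. trivial_fibration J M T A p \<and> trivial_fibration J M T B q)"

lemma trivial_fibration_span_sym:
  "trivial_fibration_span J M A B \<Longrightarrow> trivial_fibration_span J M B A"
  unfolding trivial_fibration_span_def by blast

text \<open>A model category in which every finite diagram is small, so that pullbacks and a terminal object
  exist.\<close>

locale sized_model_category = model_category +
  assumes size_cardinal: "size_cardinal \<kappa>"
begin

lemma pullback_exists:
  assumes "p \<in> Hom M x k" "q \<in> Hom M y k"
  shows "\<exists>a b. pullback_square M a q b p"
  by (rule small_limits_imp_pullback[OF size_cardinal category_axioms limits assms])

lemma trivial_fibration_comp: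
  assumes "trivial_fibration J M F G s" "trivial_fibration J M G H t"
  shows "trivial_fibration J M F H (\<lambda>x. t x \<cdot> s x)"
proof -
  have s: "nat_trans J M F G s" and t: "nat_trans J M G H t"
    using assms by (auto simp: trivial_fibration_def)
  have "t x \<cdot> s x \<in> Fib M \<inter> Weq M" if "x \<in> Obj J" for x
    using trivial_Fib_Comp[OF nat_trans.component[OF s that] nat_trans.component[OF t that]] assms that
    by (simp add: trivial_fibration_def)
  then show ?thesis using nat_trans_comp[OF s t] by (simp add: trivial_fibration_def)
qed

lemma trivial_fibration_span_refl:
  assumes "is_functor J M A"
  shows "trivial_fibration_span J M A A"
proof -
  interpret A: is_functor J M A by fact
  have "trivial_fibration J M A A (\<lambda>x. Ident M (FObj A x))"
    using nat_trans_id[OF assms] Ident_trivial_Fib A.FObj_Obj by (simp add: trivial_fibration_def)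
  then show ?thesis unfolding trivial_fibration_span_def by blast
qed

lemma trivial_fibration_pullback:
  assumes p: "nat_trans J M A K p" and q: "trivial_fibration J M B K q"
  obtains P a b where "trivial_fibration J M P A a" "nat_trans J M P B b"
    "\<And>x. x \<in> Obj J \<Longrightarrow> pullback_square M (a x) (q x) (b x) (p x)"
proof -
  have qn: "nat_trans J M B K q" using q by (simp add: trivial_fibration_def)
  obtain P a b where ab: "nat_trans J M P A a" "nat_trans J M P B b"
    and pb: "\<And>x. x \<in> Obj J \<Longrightarrow> pullback_square M (a x) (q x) (b x) (p x)"
    using functor_pullback[OF p qn pullback_exists]
      nat_trans.component[OF p] nat_trans.component[OF qn] by metis
  have "trivial_fibration J M P A a"
    using ab(1) q trivial_Fib_pullback[OF pb] by (auto simp: trivial_fibration_def)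
  then show thesis using that ab(2) pb by blast
qed

text \<open>The composite span is the pullback of the two inner legs.\<close>

lemma trivial_fibration_span_trans:
  assumes "trivial_fibration_span J M A B" "trivial_fibration_span J M B C"
  shows "trivial_fibration_span J M A C"
proof -
  obtain T p q where T: "trivial_fibration J M T A p" "trivial_fibration J M T B q"
    using assms(1) by (auto simp: trivial_fibration_span_def)
  obtain S r s where S: "trivial_fibration J M S B r" "trivial_fibration J M S C s"
    using assms(2) by (auto simp: trivial_fibration_span_def)
  have q: "nat_trans J M T B q" using T(2) by (simp add: trivial_fibration_def)
  obtain P a b where a: "trivial_fibration J M P T a" and b: "nat_trans J M P S b"
    and pb: "\<And>x. x \<in> Obj J \<Longrightarrow> pullback_square M (a x) (r x) (b x) (q x)"
    using trivial_fibration_pullback[OF q S(1)] by metis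
  have "trivial_fibration J M P S b"
    using b T(2) trivial_Fib_pullback[OF pullback_square_sym[OF pb]]
    by (auto simp: trivial_fibration_def)
  then show ?thesis
    using trivial_fibration_comp[OF a T(1)] trivial_fibration_comp[OF _ S(2)]
    unfolding trivial_fibration_span_def by blast
qed

text \<open>The base \<open>K\<close> is the constant terminal diagram in the application, where the hypotheses say that
  \<open>A\<close> and \<open>B\<close> are pointwise fibrant. The middle object comes from the graph of \<open>w\<close>, which maps \<open>A\<close>
  to the fibre product \<open>P\<close> of \<open>A\<close> and \<open>B\<close>: the factorization of the graph as a trivial cofibration
  followed by a fibration turns the projections of \<open>P\<close> into trivial fibrations.\<close>

lemma trivial_fibration_span_of_weq:
  assumes a: "nat_trans J M A K a" and aF: "\<And>x. x \<in> Obj J \<Longrightarrow> a x \<in> Fib M"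
    and b: "nat_trans J M B K b" and bF: "\<And>x. x \<in> Obj J \<Longrightarrow> b x \<in> Fib M"
    and w: "nat_trans J M A B w" and wW: "\<And>x. x \<in> Obj J \<Longrightarrow> w x \<in> Weq M"
    and over: "\<And>x. x \<in> Obj J \<Longrightarrow> b x \<cdot> w x = a x"
  shows "trivial_fibration_span J M A B"
proof -
  interpret a: nat_trans J M A K a by fact
  interpret b: nat_trans J M B K b by fact
  obtain P \<pi>\<^sub>A \<pi>\<^sub>B where \<pi>: "nat_trans J M P A \<pi>\<^sub>A" "nat_trans J M P B \<pi>\<^sub>B"
    and pb: "\<And>x. x \<in> Obj J \<Longrightarrow> pullback_square M (\<pi>\<^sub>A x) (b x) (\<pi>\<^sub>B x) (a x)"
    using functor_pullback[OF a b pullback_exists] a.component b.component by metis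
  have id: "a x \<cdot> Ident M (FObj A x) = b x \<cdot> w x" if "x \<in> Obj J" for x
    using over[OF that] Comp_Ident[OF a.component[OF that]] by simp
  obtain h where h: "nat_trans J M A P h"
      "\<And>x. x \<in> Obj J \<Longrightarrow> \<pi>\<^sub>A x \<cdot> h x = Ident M (FObj A x)" "\<And>x. x \<in> Obj J \<Longrightarrow> \<pi>\<^sub>B x \<cdot> h x = w x"
    using functor_pullback_lift[OF \<pi> a b pb nat_trans_id[OF a.F.is_functor_axioms] w id] by metis
  obtain L R E where LR: "functorial_factorization M L R E"
      "\<forall>f\<in>Arr M. L f \<in> Cof M \<inter> Weq M \<and> R f \<in> Fib M"
    using factor_trivial_cofibration by blast
  obtain T where l: "nat_trans J M A T (\<lambda>x. L (h x))" and k: "nat_trans J M T P (\<lambda>x. R (h x))"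
    and kl: "\<And>x. x \<in> Obj J \<Longrightarrow> R (h x) \<cdot> L (h x) = h x"
    using factor_nat_trans[OF LR(1) h(1)] by metis
  \<comment> \<open>Common to both legs of the span; \<open>\<pi>\<close> stands for a projection of \<open>P\<close>.\<close>
  have *: "\<pi> x \<cdot> R (h x) \<in> Fib M \<inter> Weq M"
    if \<pi>: "nat_trans J M P C \<pi>" and F: "\<pi> x \<in> Fib M" and W: "\<pi> x \<cdot> h x \<in> Weq M" and x: "x \<in> Obj J"
    for \<pi> C x
  proof -
    note hs = nat_trans.component[OF \<pi> x] nat_trans.component[OF l x] nat_trans.component[OF k x]
    have "h x \<in> Arr M" using Hom_D(1)[OF nat_trans.component[OF h(1) x]] .
    then have LRx: "L (h x) \<in> Weq M" "R (h x) \<in> Fib M" using LR(2) by blast+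
    have "(\<pi> x \<cdot> R (h x)) \<cdot> L (h x) = \<pi> x \<cdot> h x"
      using Comp_assoc[OF hs(2,3,1)] kl[OF x] by simp
    then show ?thesis
      using Weq_cancel_right[OF hs(2) Comp_Hom[OF hs(3,1)]] Fib_Comp[OF hs(3,1)] LRx F W by simp
  qed
  have F: "\<pi>\<^sub>A x \<in> Fib M" "\<pi>\<^sub>B x \<in> Fib M" if "x \<in> Obj J" for x
    using Fib_pullback[OF pb[OF that] bF[OF that]]
      Fib_pullback[OF pullback_square_sym[OF pb[OF that]] aF[OF that]] .
  have "trivial_fibration J M T A (\<lambda>x. \<pi>\<^sub>A x \<cdot> R (h x))"
    using nat_trans_comp[OF k \<pi>(1)] *[OF \<pi>(1)] F(1) h(2) Ident_trivial_Fib a.F.FObj_Obj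
    by (simp add: trivial_fibration_def)
  moreover have "trivial_fibration J M T B (\<lambda>x. \<pi>\<^sub>B x \<cdot> R (h x))"
    using nat_trans_comp[OF k \<pi>(2)] *[OF \<pi>(2)] F(2) h(3) wW
    by (simp add: trivial_fibration_def)
  ultimately show ?thesis unfolding trivial_fibration_span_def by blast
qed

text \<open>Factoring \<open>Id \<rightarrow> 1\<close> as a natural transformation of endofunctors makes \<open>Q\<close> a functor, so that it
  can be applied to whole diagrams.\<close>

lemma fibrant_replacement:
  obtains one Q l k where "terminal M one"
    "nat_trans M M id_fctr Q l" "\<And>x. x \<in> Obj M \<Longrightarrow> l x \<in> Weq M"
    "nat_trans M M Q (const_fctr M one) k" "\<And>x. x \<in> Obj M \<Longrightarrow> k x \<in> Fib M"
proof -
  obtain one where one: "terminal M one"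
    using small_limits_imp_terminal[OF size_cardinal category_axioms limits] by blast
  obtain t where t: "nat_trans M M id_fctr (const_fctr M one) t"
    using nat_trans_to_terminal[OF is_functor_id one] by blast
  obtain L R E where LR: "functorial_factorization M L R E"
      "\<forall>f\<in>Arr M. L f \<in> Cof M \<inter> Weq M \<and> R f \<in> Fib M"
    using factor_trivial_cofibration by blast
  obtain Q where l: "nat_trans M M id_fctr Q (\<lambda>x. L (t x))"
    and k: "nat_trans M M Q (const_fctr M one) (\<lambda>x. R (t x))"
    using factor_nat_trans[OF LR(1) t] by metis
  have "t x \<in> Arr M" if "x \<in> Obj M" for x
    using Hom_D(1)[OF nat_trans.component[OF t that]] .
  then show thesis using that[OF one l _ k] LR(2) by blast
qed

end


section \<open>Interleavings\<close>

lemma Rm_simps [simp]: "Obj Rm = UNIV" "Ident Rm r = (r, r)" "Comp Rm g f = (fst f, snd g)"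
  by (auto simp: ord_cat_def Field_def)

lemma Hom_Rm: "f \<in> Hom Rm r s \<longleftrightarrow> f = (r, s) \<and> r \<le> s"
  by (auto simp: ord_cat_def Hom_def)

lemma shift_simps [simp]: "FObj (shift \<delta> X) r = FObj X (r + \<delta>)"
  "FArr (shift \<delta> X) (r, s) = FArr X (r + \<delta>, s + \<delta>)"
  by (simp_all add: shift_def)

lemma shift_shift: "shift \<delta> (shift \<epsilon> X) = shift (\<delta> + \<epsilon>) X"
  by (simp add: shift_def add.assoc fun_eq_iff)

lemma fctr_comp_shift: "fctr_comp F (shift \<delta> X) = shift \<delta> (fctr_comp F X)"
  by (simp add: shift_def fctr_comp_def fun_eq_iff)

lemma FArr_Rm_Comp:
  assumes "is_functor Rm C X" "r \<le> s" "s \<le> t"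
  shows "FArr X (s, t) \<cdot>\<^bsub>C\<^esub> FArr X (r, s) = FArr X (r, t)"
  using is_functor.FArr_Comp[OF assms(1), of "(r, s)" r s "(s, t)" t] assms(2,3)
  by (simp add: Hom_Rm)

lemma FArr_Rm_Hom:
  assumes "is_functor Rm C X" "r \<le> s"
  shows "FArr X (r, s) \<in> Hom C (FObj X r) (FObj X s)"
  using is_functor.FArr_Hom[OF assms(1), of "(r, s)" r s] assms(2) by (simp add: Hom_Rm)

lemma Rm_naturality:
  assumes "nat_trans Rm C X Y t" "r \<le> s"
  shows "t s \<cdot>\<^bsub>C\<^esub> FArr X (r, s) = FArr Y (r, s) \<cdot>\<^bsub>C\<^esub> t r"
  using nat_trans.naturality[OF assms(1), of "(r, s)" r s] assms(2) by (simp add: Hom_Rm)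

lemma Rm_component:
  assumes "nat_trans Rm C X Y t"
  shows "t r \<in> Hom C (FObj X r) (FObj Y r)"
  using nat_trans.component[OF assms] by simp

lemma is_functor_shift:
  assumes "is_functor Rm C X"
  shows "is_functor Rm C (shift \<delta> X)"
proof -
  interpret X: is_functor Rm C X by fact
  show ?thesis
    using X.FObj_Obj X.FArr_Ident FArr_Rm_Hom[OF assms] FArr_Rm_Comp[OF assms]
    by (intro is_functor.intro is_functor_axioms.intro X.J.category_axioms X.C.category_axioms)
      (auto simp: Hom_Rm)
qed

lemma nat_trans_shift:
  assumes "nat_trans Rm C X Y t"
  shows "nat_trans Rm C (shift \<delta> X) (shift \<delta> Y) (shift_trans \<delta> t)"
proof -
  interpret t: nat_trans Rm C X Y t by fact
  show ?thesis
    by (rule nat_transI[OF is_functor_shift[OF t.F.is_functor_axioms] is_functor_shift[OF t.G.is_functor_axioms]])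
      (auto simp: Hom_Rm shift_trans_def Rm_component[OF assms] Rm_naturality[OF assms])
qed

lemma nat_trans_structure:
  assumes X: "is_functor Rm C X" and "0 \<le> \<delta>"
  shows "nat_trans Rm C X (shift \<delta> X) (structure_trans X \<delta>)"
  by (rule nat_transI[OF X is_functor_shift[OF X]])
    (auto simp: Hom_Rm structure_trans_def assms(2) FArr_Rm_Hom[OF X] FArr_Rm_Comp[OF X])

lemma interleaved_sym: "interleaved C \<epsilon> \<delta> X Y \<Longrightarrow> interleaved C \<delta> \<epsilon> Y X"
  unfolding interleaved_def by (metis add.commute)

lemma interleaved_is_functor:
  assumes "interleaved C \<epsilon> \<delta> X Y"
  shows "is_functor Rm C X" "is_functor Rm C Y"
  using assms unfolding interleaved_def nat_trans_def by auto

text \<open>Interleavings are given by equations between composites, which every functor preserves.\<close>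

lemma interleaved_fctr_comp:
  assumes F: "is_functor C D F" and XY: "interleaved C \<epsilon> \<delta> X Y"
  shows "interleaved D \<epsilon> \<delta> (fctr_comp F X) (fctr_comp F Y)"
proof -
  obtain f g where f: "nat_trans Rm C X (shift \<epsilon> Y) f" and g: "nat_trans Rm C Y (shift \<delta> X) g"
    and gf: "\<And>r. shift_trans \<epsilon> g r \<cdot>\<^bsub>C\<^esub> f r = structure_trans X (\<epsilon> + \<delta>) r"
    and fg: "\<And>r. shift_trans \<delta> f r \<cdot>\<^bsub>C\<^esub> g r = structure_trans Y (\<epsilon> + \<delta>) r"
    using XY unfolding interleaved_def by blast
  have "FArr F (g (r + \<epsilon>)) \<cdot>\<^bsub>D\<^esub> FArr F (f r) = FArr F (FArr X (r, r + (\<epsilon> + \<delta>)))" for r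
    using is_functor.FArr_Comp[OF F Rm_component[OF f, of r], of "g (r + \<epsilon>)"]
      Rm_component[OF g, of "r + \<epsilon>"] gf[of r]
    by (simp add: shift_trans_def structure_trans_def)
  moreover have "FArr F (f (r + \<delta>)) \<cdot>\<^bsub>D\<^esub> FArr F (g r) = FArr F (FArr Y (r, r + (\<epsilon> + \<delta>)))" for r
    using is_functor.FArr_Comp[OF F Rm_component[OF g, of r], of "f (r + \<delta>)"]
      Rm_component[OF f, of "r + \<delta>"] fg[of r]
    by (simp add: shift_trans_def structure_trans_def)
  ultimately show ?thesis
    using nat_trans_whisker_left[OF F f] nat_trans_whisker_left[OF F g]
    unfolding interleaved_def fctr_comp_shift
    by (intro exI[of _ "\<lambda>r. FArr F (f r)"] exI[of _ "\<lambda>r. FArr F (g r)"])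
      (simp add: shift_trans_def structure_trans_def fctr_comp_def)
qed

text \<open>One of the two triangle identities of a composite interleaving; the other one arises by exchanging
  the roles of the two ends. The inner round trip is a structure morphism of \<open>Y\<close>, naturality of \<open>g\<close>
  moves it past \<open>g\<close>, and what remains is the round trip through \<open>Y\<close>.\<close>

lemma interleaving_composite_round_trip:
  assumes f: "nat_trans Rm C X (shift \<epsilon>\<^sub>1 Y) f" and g: "nat_trans Rm C Y (shift \<epsilon>\<^sub>2 X) g"
    and gf: "\<And>r. shift_trans \<epsilon>\<^sub>1 g r \<cdot>\<^bsub>C\<^esub> f r = structure_trans X (\<epsilon>\<^sub>1 + \<epsilon>\<^sub>2) r"
    and h: "nat_trans Rm C Y (shift \<delta>\<^sub>1 Z) h" and k: "nat_trans Rm C Z (shift \<delta>\<^sub>2 Y) k"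
    and kh: "\<And>r. shift_trans \<delta>\<^sub>1 k r \<cdot>\<^bsub>C\<^esub> h r = structure_trans Y (\<delta>\<^sub>1 + \<delta>\<^sub>2) r"
    and nonneg: "0 \<le> \<epsilon>\<^sub>1" "0 \<le> \<epsilon>\<^sub>2" "0 \<le> \<delta>\<^sub>1" "0 \<le> \<delta>\<^sub>2"
  shows "(g (r + \<epsilon>\<^sub>1 + \<delta>\<^sub>1 + \<delta>\<^sub>2) \<cdot>\<^bsub>C\<^esub> k (r + \<epsilon>\<^sub>1 + \<delta>\<^sub>1)) \<cdot>\<^bsub>C\<^esub> (h (r + \<epsilon>\<^sub>1) \<cdot>\<^bsub>C\<^esub> f r)
    = structure_trans X (\<epsilon>\<^sub>1 + \<delta>\<^sub>1 + (\<epsilon>\<^sub>2 + \<delta>\<^sub>2)) r"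
proof -
  interpret f: nat_trans Rm C X "shift \<epsilon>\<^sub>1 Y" f by fact
  interpret g: nat_trans Rm C Y "shift \<epsilon>\<^sub>2 X" g by fact
  let ?s = "r + \<epsilon>\<^sub>1" let ?t = "?s + \<delta>\<^sub>1" let ?u = "?t + \<delta>\<^sub>2"
  note assoc = f.F.C.Comp_assoc and comp = f.F.C.Comp_Hom
  have fr: "f r \<in> Hom C (FObj X r) (FObj Y ?s)" and hs: "h ?s \<in> Hom C (FObj Y ?s) (FObj Z ?t)"
    and kt: "k ?t \<in> Hom C (FObj Z ?t) (FObj Y ?u)" and gu: "g ?u \<in> Hom C (FObj Y ?u) (FObj X (?u + \<epsilon>\<^sub>2))"
    and gs: "g ?s \<in> Hom C (FObj Y ?s) (FObj X (?s + \<epsilon>\<^sub>2))"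
    using Rm_component[OF f, of r] Rm_component[OF h, of ?s] Rm_component[OF k, of ?t]
      Rm_component[OF g, of ?u] Rm_component[OF g, of ?s] by simp_all
  have su: "?s \<le> ?u" using nonneg by (simp add: add.assoc)
  then have su2: "?s + \<epsilon>\<^sub>2 \<le> ?u + \<epsilon>\<^sub>2" by simp
  have rs: "r \<le> ?s + \<epsilon>\<^sub>2" using nonneg by (simp add: add.assoc)
  note Y = g.F.is_functor_axioms and X = f.F.is_functor_axioms
  have kh': "k ?t \<cdot>\<^bsub>C\<^esub> h ?s = FArr Y (?s, ?u)"
    using kh[of ?s] by (simp add: shift_trans_def structure_trans_def add.assoc)
  have gf': "g ?s \<cdot>\<^bsub>C\<^esub> f r = FArr X (r, ?s + \<epsilon>\<^sub>2)"
    using gf[of r] by (simp add: shift_trans_def structure_trans_def add.assoc)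
  have "(g ?u \<cdot>\<^bsub>C\<^esub> k ?t) \<cdot>\<^bsub>C\<^esub> (h ?s \<cdot>\<^bsub>C\<^esub> f r) = g ?u \<cdot>\<^bsub>C\<^esub> (FArr Y (?s, ?u) \<cdot>\<^bsub>C\<^esub> f r)"
    using assoc[OF comp[OF fr hs] kt gu] assoc[OF fr hs kt] kh' by simp
  also have "\<dots> = (FArr X (?s + \<epsilon>\<^sub>2, ?u + \<epsilon>\<^sub>2) \<cdot>\<^bsub>C\<^esub> g ?s) \<cdot>\<^bsub>C\<^esub> f r"
    using assoc[OF fr FArr_Rm_Hom[OF Y su] gu] Rm_naturality[OF g su] by simp
  also have "\<dots> = FArr X (?s + \<epsilon>\<^sub>2, ?u + \<epsilon>\<^sub>2) \<cdot>\<^bsub>C\<^esub> FArr X (r, ?s + \<epsilon>\<^sub>2)"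
    using assoc[OF fr gs FArr_Rm_Hom[OF X su2]] gf' by simp
  also have "\<dots> = FArr X (r, ?u + \<epsilon>\<^sub>2)" by (rule FArr_Rm_Comp[OF X rs su2])
  finally show ?thesis by (simp add: structure_trans_def algebra_simps)
qed

lemma interleaved_trans:
  assumes XY: "interleaved C \<epsilon>\<^sub>1 \<epsilon>\<^sub>2 X Y" and YZ: "interleaved C \<delta>\<^sub>1 \<delta>\<^sub>2 Y Z"
    and nonneg: "0 \<le> \<epsilon>\<^sub>1" "0 \<le> \<epsilon>\<^sub>2" "0 \<le> \<delta>\<^sub>1" "0 \<le> \<delta>\<^sub>2"
  shows "interleaved C (\<epsilon>\<^sub>1 + \<delta>\<^sub>1) (\<epsilon>\<^sub>2 + \<delta>\<^sub>2) X Z"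
proof -
  obtain f g where f: "nat_trans Rm C X (shift \<epsilon>\<^sub>1 Y) f" and g: "nat_trans Rm C Y (shift \<epsilon>\<^sub>2 X) g"
    and gf: "\<And>r. shift_trans \<epsilon>\<^sub>1 g r \<cdot>\<^bsub>C\<^esub> f r = structure_trans X (\<epsilon>\<^sub>1 + \<epsilon>\<^sub>2) r"
    and fg: "\<And>r. shift_trans \<epsilon>\<^sub>2 f r \<cdot>\<^bsub>C\<^esub> g r = structure_trans Y (\<epsilon>\<^sub>2 + \<epsilon>\<^sub>1) r"
    using XY unfolding interleaved_def by (metis add.commute)
  obtain h k where h: "nat_trans Rm C Y (shift \<delta>\<^sub>1 Z) h" and k: "nat_trans Rm C Z (shift \<delta>\<^sub>2 Y) k"
    and kh: "\<And>r. shift_trans \<delta>\<^sub>1 k r \<cdot>\<^bsub>C\<^esub> h r = structure_trans Y (\<delta>\<^sub>1 + \<delta>\<^sub>2) r"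
    and hk: "\<And>r. shift_trans \<delta>\<^sub>2 h r \<cdot>\<^bsub>C\<^esub> k r = structure_trans Z (\<delta>\<^sub>2 + \<delta>\<^sub>1) r"
    using YZ unfolding interleaved_def by (metis add.commute)
  let ?F = "\<lambda>r. shift_trans \<epsilon>\<^sub>1 h r \<cdot>\<^bsub>C\<^esub> f r" and ?G = "\<lambda>r. shift_trans \<delta>\<^sub>2 g r \<cdot>\<^bsub>C\<^esub> k r"
  have "nat_trans Rm C X (shift (\<epsilon>\<^sub>1 + \<delta>\<^sub>1) Z) ?F"
    using nat_trans_comp[OF f nat_trans_shift[OF h]] by (simp add: shift_shift)
  moreover have "nat_trans Rm C Z (shift (\<epsilon>\<^sub>2 + \<delta>\<^sub>2) X) ?G"
    using nat_trans_comp[OF k nat_trans_shift[OF g]] by (simp add: shift_shift add.commute)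
  moreover have "shift_trans (\<epsilon>\<^sub>1 + \<delta>\<^sub>1) ?G r \<cdot>\<^bsub>C\<^esub> ?F r
      = structure_trans X (\<epsilon>\<^sub>1 + \<delta>\<^sub>1 + (\<epsilon>\<^sub>2 + \<delta>\<^sub>2)) r" for r
    using interleaving_composite_round_trip[OF f g gf h k kh nonneg, of r]
    by (simp add: shift_trans_def add.assoc)
  moreover have "shift_trans (\<epsilon>\<^sub>2 + \<delta>\<^sub>2) ?F r \<cdot>\<^bsub>C\<^esub> ?G r
      = structure_trans Z (\<epsilon>\<^sub>1 + \<delta>\<^sub>1 + (\<epsilon>\<^sub>2 + \<delta>\<^sub>2)) r" for r
    using interleaving_composite_round_trip[OF k h hk g f fg nonneg(4,3,2,1), of r]
    by (simp add: shift_trans_def algebra_simps)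
  ultimately show ?thesis unfolding interleaved_def by blast
qed

context sized_model_category
begin

text \<open>The new end is \<open>P = X \<times> T\<^sup>\<epsilon>\<close> over \<open>Y\<^sup>\<epsilon>\<close>. Its interleaving with \<open>T\<close> consists of the projection
  \<open>b : P \<rightarrow> T\<^sup>\<epsilon>\<close> and of the map \<open>u : T \<rightarrow> P\<^sup>\<delta>\<close> with components \<open>T \<rightarrow> Y \<rightarrow> X\<^sup>\<delta>\<close> and the structure
  morphism \<open>T \<rightarrow> T\<^sup>\<delta>\<^sup>+\<^sup>\<epsilon>\<close>. The triangle identity at \<open>T\<close> holds by construction; the one at \<open>P\<close> is
  checked after the two projections.\<close>

lemma interleaved_trivial_fibration_pullback:
  assumes XY: "interleaved M \<epsilon> \<delta> X Y" and p: "trivial_fibration Rm M T Y p" and nonneg: "0 \<le> \<epsilon>" "0 \<le> \<delta>"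
  obtains P a where "trivial_fibration Rm M P X a" "interleaved M \<epsilon> \<delta> P T"
proof -
  obtain f g where f: "nat_trans Rm M X (shift \<epsilon> Y) f" and g: "nat_trans Rm M Y (shift \<delta> X) g"
    and gf: "\<And>r. g (r + \<epsilon>) \<cdot> f r = FArr X (r, r + (\<epsilon> + \<delta>))"
    and fg: "\<And>r. f (r + \<delta>) \<cdot> g r = FArr Y (r, r + (\<epsilon> + \<delta>))"
    using XY unfolding interleaved_def shift_trans_def structure_trans_def by blast
  have pn: "nat_trans Rm M T Y p" using p by (simp add: trivial_fibration_def)
  interpret p: nat_trans Rm M T Y p by fact
  note T = p.F.is_functor_axioms
  have "trivial_fibration Rm M (shift \<epsilon> T) (shift \<epsilon> Y) (shift_trans \<epsilon> p)"
    using p nat_trans_shift[OF pn] by (simp add: trivial_fibration_def shift_trans_def)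
  from trivial_fibration_pullback[OF f this]
  obtain P a b where a: "trivial_fibration Rm M P X a" and b: "nat_trans Rm M P (shift \<epsilon> T) b"
    and pb: "\<And>r. pullback_square M (a r) (shift_trans \<epsilon> p r) (b r) (f r)"
    by auto
  have an: "nat_trans Rm M P X a" using a by (simp add: trivial_fibration_def)
  have P: "is_functor Rm M P" using an by (simp add: nat_trans_def)
  have \<delta>\<epsilon>: "0 \<le> \<delta> + \<epsilon>" and le: "r \<le> r + (\<epsilon> + \<delta>)" for r using nonneg by simp_all
  have s: "nat_trans Rm M T (shift \<delta> X) (\<lambda>r. g r \<cdot> p r)"
    by (rule nat_trans_comp[OF pn g])
  have t: "nat_trans Rm M T (shift \<delta> (shift \<epsilon> T)) (structure_trans T (\<delta> + \<epsilon>))"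
    unfolding shift_shift by (rule nat_trans_structure[OF T \<delta>\<epsilon>])
  \<comment> \<open>The two components of \<open>u\<close> agree in the shift of \<open>Y\<close>, by the triangle identity of \<open>(f, g)\<close>
    at \<open>Y\<close> and the naturality of \<open>p\<close>.\<close>
  have eq: "shift_trans \<delta> f r \<cdot> (g r \<cdot> p r)
      = shift_trans \<delta> (shift_trans \<epsilon> p) r \<cdot> structure_trans T (\<delta> + \<epsilon>) r" for r
  proof -
    have gr: "g r \<in> Hom M (FObj Y r) (FObj X (r + \<delta>))"
      and fr: "f (r + \<delta>) \<in> Hom M (FObj X (r + \<delta>)) (FObj Y (r + \<delta> + \<epsilon>))"
      using Rm_component[OF g, of r] Rm_component[OF f, of "r + \<delta>"] by simp_all
    have "f (r + \<delta>) \<cdot> (g r \<cdot> p r) = FArr Y (r, r + (\<epsilon> + \<delta>)) \<cdot> p r"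
      using Comp_assoc[OF Rm_component[OF pn] gr fr] fg[of r] by simp
    also have "\<dots> = p (r + (\<epsilon> + \<delta>)) \<cdot> FArr T (r, r + (\<epsilon> + \<delta>))"
      using Rm_naturality[OF pn le] by simp
    finally show ?thesis by (simp add: shift_trans_def structure_trans_def algebra_simps)
  qed
  have pb\<delta>: "pullback_square M (shift_trans \<delta> a r) (shift_trans \<delta> (shift_trans \<epsilon> p) r)
      (shift_trans \<delta> b r) (shift_trans \<delta> f r)" for r
    using pb[of "r + \<delta>"] by (simp add: shift_trans_def)
  obtain u where u: "nat_trans Rm M T (shift \<delta> P) u"
    and au: "\<And>r. a (r + \<delta>) \<cdot> u r = g r \<cdot> p r"
    and bu: "\<And>r. b (r + \<delta>) \<cdot> u r = structure_trans T (\<epsilon> + \<delta>) r"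
    using functor_pullback_lift[OF nat_trans_shift[OF an] nat_trans_shift[OF b] nat_trans_shift[OF f]
        nat_trans_shift[OF nat_trans_shift[OF pn]] pb\<delta> s t eq]
    by (auto simp: shift_trans_def add.commute)
  have "u (r + \<epsilon>) \<cdot> b r = FArr P (r, r + (\<epsilon> + \<delta>))" for r
  proof -
    let ?s = "r + \<epsilon>" and ?t = "r + (\<epsilon> + \<delta>)"
    have st: "?s \<le> ?s + (\<epsilon> + \<delta>)" by (rule le)
    have ur: "u ?s \<in> Hom M (FObj T ?s) (FObj P ?t)"
      and br: "b r \<in> Hom M (FObj P r) (FObj T ?s)"
      and bt: "b ?t \<in> Hom M (FObj P ?t) (FObj T (?t + \<epsilon>))"
      and fr: "f r \<in> Hom M (FObj X r) (FObj Y ?s)"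
      and gs: "g ?s \<in> Hom M (FObj Y ?s) (FObj X ?t)"
      using Rm_component[OF u, of ?s] Rm_component[OF b, of r] Rm_component[OF b, of ?t]
        Rm_component[OF f, of r] Rm_component[OF g, of ?s] by (simp_all add: add.assoc)
    note ar = Rm_component[OF an, of r] and at = Rm_component[OF an, of ?t]
    note Pr = FArr_Rm_Hom[OF P le, of r] and ps = Rm_component[OF pn, of ?s]
    have sq: "p ?s \<cdot> b r = f r \<cdot> a r"
      using pb[of r] by (simp add: pullback_square_def square_def shift_trans_def)
    have au': "a ?t \<cdot> u ?s = g ?s \<cdot> p ?s" using au[of ?s] by (simp add: add.assoc)
    have bu': "b ?t \<cdot> u ?s = FArr T (?s, ?s + (\<epsilon> + \<delta>))"
      using bu[of ?s] by (simp add: add.assoc structure_trans_def)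
    show ?thesis
    proof (rule pullback_jointly_mono[OF pb[of ?t], of _ "FObj P r"])
      show "u ?s \<cdot> b r \<in> Hom M (FObj P r) (Dom M (a ?t))"
        "FArr P (r, ?t) \<in> Hom M (FObj P r) (Dom M (a ?t))"
        using Comp_Hom[OF br ur] Pr Hom_D(2)[OF at] by simp_all
      have "a ?t \<cdot> (u ?s \<cdot> b r) = g ?s \<cdot> (f r \<cdot> a r)"
        using Comp_assoc[OF br ur at] Comp_assoc[OF br ps gs] au' sq by simp
      also have "\<dots> = a ?t \<cdot> FArr P (r, ?t)"
        using Comp_assoc[OF ar fr gs] gf[of r] Rm_naturality[OF an le] by simp
      finally show "a ?t \<cdot> (u ?s \<cdot> b r) = a ?t \<cdot> FArr P (r, ?t)" .
      have "b ?t \<cdot> (u ?s \<cdot> b r) = FArr T (?s, ?s + (\<epsilon> + \<delta>)) \<cdot> b r"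
        using Comp_assoc[OF br ur bt] bu' by simp
      also have "\<dots> = b ?t \<cdot> FArr P (r, ?t)"
        using Rm_naturality[OF b le[of r]] by (simp add: algebra_simps)
      finally show "b ?t \<cdot> (u ?s \<cdot> b r) = b ?t \<cdot> FArr P (r, ?t)" .
    qed
  qed
  then have "interleaved M \<epsilon> \<delta> P T"
    using b u bu unfolding interleaved_def shift_trans_def structure_trans_def by blast
  then show thesis using that a by blast
qed

text \<open>Here \<open>Q\<close> is a fibrant replacement functor with unit \<open>l\<close>. It preserves weak equivalences by two
  out of three in the naturality squares of \<open>l\<close>.\<close>

lemma weak_equivalence_imp_span:
  assumes one: "terminal M one"
    and l: "nat_trans M M id_fctr Q l" and lW: "\<And>x. x \<in> Obj M \<Longrightarrow> l x \<in> Weq M"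
    and k: "nat_trans M M Q (const_fctr M one) k" and kF: "\<And>x. x \<in> Obj M \<Longrightarrow> k x \<in> Fib M"
    and AB: "weak_equivalence M A B"
  shows "trivial_fibration_span Rm M (fctr_comp Q A) (fctr_comp Q B)"
proof -
  interpret l: nat_trans M M id_fctr Q l by fact
  obtain t where t: "nat_trans Rm M A B t" and tW: "\<And>r. t r \<in> Weq M"
    using AB unfolding weak_equivalence_def by blast
  interpret t: nat_trans Rm M A B t by fact
  have kA: "nat_trans Rm M (fctr_comp Q A) (const_fctr M one) (\<lambda>r. k (FObj A r))"
    and kB: "nat_trans Rm M (fctr_comp Q B) (const_fctr M one) (\<lambda>r. k (FObj B r))"
    using nat_trans_whisker_right[OF k t.F.is_functor_axioms]
      nat_trans_whisker_right[OF k t.G.is_functor_axioms] by (simp_all add: fctr_comp_const)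
  have Qt: "nat_trans Rm M (fctr_comp Q A) (fctr_comp Q B) (\<lambda>r. FArr Q (t r))"
    by (rule nat_trans_whisker_left[OF l.G.is_functor_axioms t])
  have obj: "FObj A r \<in> Obj M" "FObj B r \<in> Obj M" for r
    using t.F.FObj_Obj t.G.FObj_Obj by simp_all
  have l_Hom: "l x \<in> Hom M x (FObj Q x)" if "x \<in> Obj M" for x
    using l.component[OF that] by (simp add: id_fctr_def)
  have QtW: "FArr Q (t r) \<in> Weq M" for r
  proof -
    note tr = Rm_component[OF t, of r]
    have "FArr Q (t r) \<cdot> l (FObj A r) = l (FObj B r) \<cdot> t r"
      using l.naturality[OF tr] by (simp add: id_fctr_def)
    moreover have "l (FObj B r) \<cdot> t r \<in> Weq M"
      by (rule Weq_Comp[OF tr l_Hom[OF obj(2)] tW lW[OF obj(2)]])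
    ultimately show ?thesis
      using Weq_cancel_right[OF l_Hom[OF obj(1)] l.G.FArr_Hom[OF tr] lW[OF obj(1)]] by simp
  qed
  have over: "k (FObj B r) \<cdot> FArr Q (t r) = k (FObj A r)" for r
    using Rm_component[OF nat_trans_comp[OF Qt kB], of r] Rm_component[OF kA, of r]
    by (auto intro: terminal_unique[OF one category_axioms])
  show ?thesis
    by (rule trivial_fibration_span_of_weq[OF kA _ kB _ Qt]) (simp_all add: kF obj QtW over)
qed

lemma weakly_equivalent_imp_span:
  assumes one: "terminal M one"
    and l: "nat_trans M M id_fctr Q l" and lW: "\<And>x. x \<in> Obj M \<Longrightarrow> l x \<in> Weq M"
    and k: "nat_trans M M Q (const_fctr M one) k" and kF: "\<And>x. x \<in> Obj M \<Longrightarrow> k x \<in> Fib M"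
    and AB: "weakly_equivalent M A B" and A: "is_functor Rm M A"
  shows "trivial_fibration_span Rm M (fctr_comp Q A) (fctr_comp Q B)"
  using AB unfolding weakly_equivalent_def
proof (induction rule: equivclp_induct)
  case base
  have "is_functor M M Q" using l by (simp add: nat_trans_def)
  then show ?case by (intro trivial_fibration_span_refl is_functor_comp[OF _ A])
next
  case (step y z)
  then show ?case
    using weak_equivalence_imp_span[OF one l lW k kF] trivial_fibration_span_sym
      trivial_fibration_span_trans by blast
qed

lemma trivial_fibration_replacement_weakly_equivalent:
  assumes l: "nat_trans M M id_fctr Q l" and lW: "\<And>x. x \<in> Obj M \<Longrightarrow> l x \<in> Weq M"
    and a: "trivial_fibration Rm M A' (fctr_comp Q A) a" and A: "is_functor Rm M A"
  shows "weakly_equivalent M A' A"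
proof -
  have "weak_equivalence M A' (fctr_comp Q A)"
    using a by (auto simp: trivial_fibration_def weak_equivalence_def)
  moreover have "weak_equivalence M A (fctr_comp Q A)"
    using nat_trans_whisker_right[OF l A] lW is_functor.FObj_Obj[OF A]
    unfolding weak_equivalence_def fctr_comp_id by auto
  ultimately show ?thesis
    unfolding weakly_equivalent_def by (meson r_into_equivclp equivclp_sym equivclp_trans)
qed

lemma homotopy_interleaved_trans:
  assumes nonneg: "0 \<le> \<epsilon>\<^sub>1" "0 \<le> \<epsilon>\<^sub>2" "0 \<le> \<delta>\<^sub>1" "0 \<le> \<delta>\<^sub>2"
    and XY: "homotopy_interleaved M \<epsilon>\<^sub>1 \<epsilon>\<^sub>2 X Y" and YZ: "homotopy_interleaved M \<delta>\<^sub>1 \<delta>\<^sub>2 Y Z"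
  shows "homotopy_interleaved M (\<epsilon>\<^sub>1 + \<delta>\<^sub>1) (\<epsilon>\<^sub>2 + \<delta>\<^sub>2) X Z"
proof -
  obtain X\<^sub>1 Y\<^sub>1 where XY\<^sub>1: "weakly_equivalent M X\<^sub>1 X" "weakly_equivalent M Y\<^sub>1 Y"
      "interleaved M \<epsilon>\<^sub>1 \<epsilon>\<^sub>2 X\<^sub>1 Y\<^sub>1"
    using XY unfolding homotopy_interleaved_def by blast
  obtain Y\<^sub>2 Z\<^sub>2 where YZ\<^sub>2: "weakly_equivalent M Y\<^sub>2 Y" "weakly_equivalent M Z\<^sub>2 Z"
      "interleaved M \<delta>\<^sub>1 \<delta>\<^sub>2 Y\<^sub>2 Z\<^sub>2"
    using YZ unfolding homotopy_interleaved_def by blast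
  note fct = interleaved_is_functor[OF XY\<^sub>1(3)] interleaved_is_functor[OF YZ\<^sub>2(3)]
  obtain one Q l k where Q: "terminal M one"
    "nat_trans M M id_fctr Q l" "\<And>x. x \<in> Obj M \<Longrightarrow> l x \<in> Weq M"
    "nat_trans M M Q (const_fctr M one) k" "\<And>x. x \<in> Obj M \<Longrightarrow> k x \<in> Fib M"
    using fibrant_replacement by metis
  have QF: "is_functor M M Q" using Q(2) by (simp add: nat_trans_def)
  have "weakly_equivalent M Y\<^sub>1 Y\<^sub>2"
    using XY\<^sub>1(2) YZ\<^sub>2(1) unfolding weakly_equivalent_def
    by (meson equivclp_sym equivclp_trans)
  from weakly_equivalent_imp_span[OF Q this fct(2)]
  obtain T p q where T: "trivial_fibration Rm M T (fctr_comp Q Y\<^sub>1) p"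
      "trivial_fibration Rm M T (fctr_comp Q Y\<^sub>2) q"
    unfolding trivial_fibration_span_def by blast
  obtain X' a where X': "trivial_fibration Rm M X' (fctr_comp Q X\<^sub>1) a" "interleaved M \<epsilon>\<^sub>1 \<epsilon>\<^sub>2 X' T"
    using interleaved_trivial_fibration_pullback[OF interleaved_fctr_comp[OF QF XY\<^sub>1(3)] T(1) nonneg(1,2)]
    by blast
  obtain Z' c where Z': "trivial_fibration Rm M Z' (fctr_comp Q Z\<^sub>2) c" "interleaved M \<delta>\<^sub>2 \<delta>\<^sub>1 Z' T"
    using interleaved_trivial_fibration_pullback[OF
        interleaved_sym[OF interleaved_fctr_comp[OF QF YZ\<^sub>2(3)]] T(2) nonneg(4,3)]
    by blast
  have "weakly_equivalent M X' X" "weakly_equivalent M Z' Z"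
    using trivial_fibration_replacement_weakly_equivalent[OF Q(2,3) X'(1) fct(1)]
      trivial_fibration_replacement_weakly_equivalent[OF Q(2,3) Z'(1) fct(4)] XY\<^sub>1(1) YZ\<^sub>2(2)
    unfolding weakly_equivalent_def by (meson equivclp_trans)+
  moreover have "interleaved M (\<epsilon>\<^sub>1 + \<delta>\<^sub>1) (\<epsilon>\<^sub>2 + \<delta>\<^sub>2) X' Z'"
    by (rule interleaved_trans[OF X'(2) interleaved_sym[OF Z'(2)] nonneg])
  ultimately show ?thesis
    unfolding homotopy_interleaved_def by blast
qed

end

theorem proposition2p3:
  fixes \<kappa> :: "'u rel"
    and M :: "('o, 'a) model_cat"
    and X Y Z :: "('m::finite, 'o, 'a) persistent"
    and \<epsilon>\<^sub>1 \<epsilon>\<^sub>2 \<delta>\<^sub>1 \<delta>\<^sub>2 :: "real ^ 'm"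
  assumes "size_cardinal \<kappa>"
    and "cofibrantly_generated_model_category \<kappa> M"
    and "is_functor Rm M X" "is_functor Rm M Y" "is_functor Rm M Z"
    and "0 \<le> \<epsilon>\<^sub>1" "0 \<le> \<epsilon>\<^sub>2" "0 \<le> \<delta>\<^sub>1" "0 \<le> \<delta>\<^sub>2"
    and "homotopy_interleaved M \<epsilon>\<^sub>1 \<epsilon>\<^sub>2 X Y"
    and "homotopy_interleaved M \<delta>\<^sub>1 \<delta>\<^sub>2 Y Z"
  shows "homotopy_interleaved M (\<epsilon>\<^sub>1 + \<delta>\<^sub>1) (\<epsilon>\<^sub>2 + \<delta>\<^sub>2) X Z"
proof -
  interpret sized_model_category \<kappa> M
    using assms(1,2)
    by (simp add: sized_model_category_def sized_model_category_axioms_def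
        cofibrantly_generated_model_category_def)
  show ?thesis by (rule homotopy_interleaved_trans[OF assms(6-11)])
qed

end
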